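(* Let $\{a_{ij}: i\le j,\ i,j\in\mathbb{N}\}$ be jointly independent, identically distributed real random variables with all moments finite, $X_k:=\mathbb{E}a_{ij}^k<\infty$, and set $a_{ji}=a_{ij}$. Fix $p>0$, $\alpha\in(0,1)$. For $N\ge p$ let $\{d^{(N,p)}_{ij}: i\le j\le N\}$ be jointly independent Bernoulli variables, independent of $\{a_{ij}\}$, equal to $1$ with probability $p/N$ and $0$ otherwise, with $d^{(N,p)}_{ji}=d^{(N,p)}_{ij}$. With $I_{\alpha,N}=\{1,\dots,\lfloor\alpha N\rfloor\}$, let $A^{(N,p,\alpha)}$ be the $N\times N$ symmetric matrix with $[A^{(N,p,\alpha)}]_{ij}=a_{ij}d^{(N,p)}_{ij}$ if exactly one of $i,j$ lies in $I_{\alpha,N}$, and $0$ otherwise. Let $\mathcal{M}^{(N,p,\alpha)}_k=\frac1N\operatorname{Tr}\big[(A^{(N,p,\alpha)})^k\big]$ (the $k$-th moment of the normalized eigenvalue counting measure), $M^{(N,p,\alpha)}_k=\mathbb{E}\mathcal{M}^{(N,p,\alpha)}_k$ and $C^{(N,p,\alpha)}_{k,m}=\mathbb{E}\{\mathcal{M}^{(N,p,\alpha)}_k\mathcal{M}^{(N,p,\alpha)}_m\}-\mathbb{E}\mathcal{M}^{(N,p,\alpha)}_k\,\mathbb{E}\mathcal{M}^{(N,p,\alpha)}_m$. Define $S^{(1)}(l,r),S^{(2)}(l,r)$ for integers $0\le r\le l$ by $S^{(1)}(l,0)=\alpha\,\delta_{l,0}$, $S^{(2)}(l,0)=(1-\alpha)\,\delta_{l,0}$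 and, for $r\ge 1$, $$S^{(1)}(l,r)=p\sum_{f=1}^{r}\binom{r-1}{f-1}X_{2f}\sum_{u=0}^{l-r}S^{(1)}(l-u-f,r-f)\sum_{v=0}^{u}\binom{f+v-1}{f-1}S^{(2)}(u,v),$$ $$S^{(2)}(l,r)=p\sum_{f=1}^{r}\binom{r-1}{f-1}X_{2f}\sum_{u=0}^{l-r}S^{(2)}(l-u-f,r-f)\sum_{v=0}^{u}\binom{f+v-1}{f-1}S^{(1)}(u,v),$$ and put $m^{(p,\alpha)}_k=\sum_{i=0}^k\big(S^{(1)}(k,i)+S^{(2)}(k,i)\big)$. Assume there is a constant $C$ with $X_{2m}\le(Cm)^{2m}$ for all $m\in\mathbb{N}$. Then: (i) for all $k,m\in\mathbb{N}$ there is a constant $C(k,m,p,\alpha)$ such that $C^{(N,p,\alpha)}_{k,m}\le C(k,m,p,\alpha)/N$ for all sufficiently large $N$; (ii) for every $s\in\mathbb{N}$ the limit $\lim_{N\to\infty}M^{(N,p,\alpha)}_s$ exists and equals $m^{(p,\alpha)}_k$ if $s=2k$ and $0$ if $s=2k-1$; (iii) the numbers $m^{(p,\alpha)}_k$ satisfy Carleman's condition $\sum_{k=1}^\infty \big(m^{(p,\alpha)}_k\big)^{-1/(2k)}=\infty$.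
   Context: $\lfloor\cdot\rfloor$ denotes the floor function and $\delta_{l,0}$ the Kronecker delta. *)

theory Defs
  imports "HOL-Probability.Probability" "Jordan_Normal_Form.Matrix"
begin

text \<open>The recursion S^(1) (b = True) and S^(2) (b = False); only meaningful for r \<le> l.\<close>
function S_rec :: "real \<Rightarrow> real \<Rightarrow> (nat \<Rightarrow> real) \<Rightarrow> bool \<Rightarrow> nat \<Rightarrow> nat \<Rightarrow> real" where
  "S_rec p \<alpha> X b l r =
    (if r > l then 0
     else if r = 0 then (if l = 0 then (if b then \<alpha> else 1 - \<alpha>) else 0)
     else p * (\<Sum>f = 1..r. real ((r - 1) choose (f - 1)) * X (2 * f) *
            (\<Sum>u = 0..l - r. S_rec p \<alpha> X b (l - u - f) (r - f) *
               (\<Sum>v = 0..u. real ((f + v - 1) choose (f - 1)) * S_rec p \<alpha> X (\<not> b) u v))))"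
  by pat_completeness auto
termination
  by (relation "Wellfounded.measure (\<lambda>(p, \<alpha>, X, b, l, r). l)") auto

definition S1 :: "real \<Rightarrow> real \<Rightarrow> (nat \<Rightarrow> real) \<Rightarrow> nat \<Rightarrow> nat \<Rightarrow> real" where
  "S1 p \<alpha> X l r = S_rec p \<alpha> X True l r"

definition S2 :: "real \<Rightarrow> real \<Rightarrow> (nat \<Rightarrow> real) \<Rightarrow> nat \<Rightarrow> nat \<Rightarrow> real" where
  "S2 p \<alpha> X l r = S_rec p \<alpha> X False l r"

definition lim_moment :: "real \<Rightarrow> real \<Rightarrow> (nat \<Rightarrow> real) \<Rightarrow> nat \<Rightarrow> real" where
  "lim_moment p \<alpha> X k = (\<Sum>i = 0..k. S1 p \<alpha> X k i + S2 p \<alpha> X k i)"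

text \<open>The random matrix A^(N,p,alpha) at sample point x (0-based indices, I = {0..<floor(alpha N)}).\<close>
definition A_mat :: "(nat \<Rightarrow> nat \<Rightarrow> 'a \<Rightarrow> real) \<Rightarrow> (nat \<Rightarrow> nat \<Rightarrow> nat \<Rightarrow> 'a \<Rightarrow> real)
    \<Rightarrow> real \<Rightarrow> nat \<Rightarrow> 'a \<Rightarrow> real mat" where
  "A_mat a d \<alpha> N x = mat N N (\<lambda>(i, j).
     if (i < nat \<lfloor>\<alpha> * real N\<rfloor>) \<noteq> (j < nat \<lfloor>\<alpha> * real N\<rfloor>) then a i j x * d N i j x else 0)"

definition norm_moment :: "(nat \<Rightarrow> nat \<Rightarrow> 'a \<Rightarrow> real) \<Rightarrow> (nat \<Rightarrow> nat \<Rightarrow> nat \<Rightarrow> 'a \<Rightarrow> real)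
    \<Rightarrow> real \<Rightarrow> nat \<Rightarrow> nat \<Rightarrow> 'a \<Rightarrow> real" where
  "norm_moment a d \<alpha> N k x = (\<Sum>i<N. (A_mat a d \<alpha> N x ^\<^sub>m k) $$ (i, i)) / real N"

text \<open>Carleman term, with the convention 0^(-1/(2k)) = \<infinity>.\<close>
definition carleman_term :: "real \<Rightarrow> nat \<Rightarrow> ennreal" where
  "carleman_term m k = (if m = 0 then \<infinity> else ennreal (m powr (- 1 / (2 * real k))))"

end

theory Submission
  imports Defs "HOL-Computational_Algebra.Formal_Power_Series"
begin

text \<open>
  Traces of powers are sums over closed walks, and the expectation of a walk is a product over its
  distinct edges, each contributing a factor \<open>p / N\<close> and a moment of \<open>a\<close>. There are \<open>O(N ^ v)\<close> walks
  on \<open>v\<close> vertices, while a connected graph on \<open>v\<close> vertices has at least \<open>v - 1\<close> edges. Hence pairs of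
  walks sharing an edge contribute \<open>O(N)\<close> to the covariance of the traces, and walks containing a
  cycle are negligible for the expectation.

  A closed walk based at \<open>i\<close> whose first step goes to \<open>j\<close> and which has no cycle splits along the edge
  \<open>{i, j}\<close> into two disjoint closed walks based at \<open>i\<close> and \<open>j\<close>. If \<open>L\<close> denotes the generating series of
  first-return loops, the numbers of ways to merge the two walks are the coefficients of
  \<open>y (y + L) ^ (r - 1)\<close> and of \<open>1 / (1 - L) ^ f\<close>. Up to \<open>O(1 / N)\<close> this is the recursion defining \<open>S\<close>,
  and the limit follows by induction on the length of the walk.

  For Carleman's condition, the same recursion gives \<open>\<Sum>r. S(l, r) \<le> B ^ l * (l!)^2\<close> by induction.
\<close>

subsection \<open>Growth of the limiting moments\<close>

text \<open>The obstacle is to match the binomial weights of the recursion with walks without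
  describing trees. The splitting along \<open>{i, j}\<close> is therefore proved as an identity of
  power series valid for every symmetric matrix; integrating both sides turns it into an identity of
  moments, in place of a correspondence of walks that keeps track of edge multiplicities. The walks
  that are split may still contain cycles: \<open>good\<close> only restricts how each loop at
  \<open>i\<close> uses the edge \<open>{i, j}\<close>. What is discarded, namely walks with a loop
  that leaves and returns by different edges and pairs of pieces that meet, loses a factor
  \<open>N\<close>, because vertices minus edges cannot increase when a path is attached to a graph.
  The second index \<open>r\<close> counts the returns to the base point, which is the information
  needed to merge two walks. For Carleman's condition, \<open>(l!)^2\<close> is the growth
  reproduced by the binomial weights, and it agrees with \<open>l^(2l)\<close> up to a geometric
  factor, so the terms are bounded below by those of a harmonic series.\<close>

declare S_rec.simps [simp del]

lemma S_rec_above: "l < r \<Longrightarrow> S_rec p \<alpha> X b l r = 0"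
  by (subst S_rec.simps) simp

lemma S_rec_at_0: "S_rec p \<alpha> X b l 0 = (if l = 0 then (if b then \<alpha> else 1 - \<alpha>) else 0)"
  by (subst S_rec.simps) simp

lemma S_rec_unfold:
  assumes "1 \<le> r" "r \<le> l"
  shows "S_rec p \<alpha> X b l r = p * (\<Sum>f = 1..r. real ((r - 1) choose (f - 1)) * X (2 * f) *
            (\<Sum>u = 0..l - r. S_rec p \<alpha> X b (l - u - f) (r - f) *
               (\<Sum>v = 0..u. real ((f + v - 1) choose (f - 1)) * S_rec p \<alpha> X (\<not> b) u v)))"
  using assms by (subst S_rec.simps) simp

lemma S_rec_nonneg:
  assumes "0 \<le> p" "0 \<le> \<alpha>" "\<alpha> \<le> 1" "\<And>f. 0 \<le> X (2 * f)"
  shows "0 \<le> S_rec p \<alpha> X b l r"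
proof (induction l arbitrary: b r rule: less_induct)
  case (less l)
  consider "l < r" | "r = 0" | "1 \<le> r" "r \<le> l" by linarith
  then show ?case
  proof cases
    case 3
    have "0 \<le> S_rec p \<alpha> X b (l - u - f) (r - f) *
               (\<Sum>v = 0..u. real ((f + v - 1) choose (f - 1)) * S_rec p \<alpha> X (\<not> b) u v)"
      if "f \<in> {1..r}" "u \<in> {0..l - r}" for f u
    proof -
      have "l - u - f < l" "u < l" using that 3 by auto
      then show ?thesis
        by (intro mult_nonneg_nonneg sum_nonneg less.IH) auto
    qed
    then show ?thesis
      unfolding S_rec_unfold[OF 3] using assms
      by (intro mult_nonneg_nonneg[OF assms(1)] sum_nonneg
          mult_nonneg_nonneg[OF mult_nonneg_nonneg sum_nonneg]) auto
  qed (use assms in \<open>auto simp: S_rec_above S_rec_at_0\<close>)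
qed

lemma le_binomial: "0 < u \<Longrightarrow> u < l \<Longrightarrow> l \<le> l choose u"
proof (induction l arbitrary: u)
  case (Suc l)
  then obtain t where t: "u = Suc t" "t < l" by (cases u) auto
  show ?case
  proof (cases "t = 0 \<or> Suc t = l")
    case True
    then show ?thesis using t by (auto simp: binomial_eq_0_iff)
  next
    case False
    then have "l \<le> l choose t" "0 < l choose Suc t" using Suc.IH[of t] t by auto
    then show ?thesis using t by (simp del: zero_less_binomial_iff)
  qed
qed simp

text \<open>The two end terms equal 1 and every other one is at most \<open>1 / l\<close>. That the
  bound is uniform in \<open>l\<close> is what keeps the growth in \<open>S_rec_sum_bound\<close> at
  \<open>(l!)^2\<close>; it is the source of the 4 there.\<close>

lemma sum_inverse_binomial_le: "(\<Sum>u\<le>l. 1 / real (l choose u)) \<le> 4"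
proof (cases "l = 0")
  case False
  have "(\<Sum>u\<le>l. 1 / real (l choose u))
      \<le> (\<Sum>u\<le>l. (if u = 0 then 1 else 0) + (if u = l then 1 else 0) + 1 / real l)"
  proof (rule sum_mono)
    fix u assume u: "u \<in> {..l}"
    show "1 / real (l choose u) \<le> (if u = 0 then 1 else 0) + (if u = l then 1 else 0) + 1 / real l"
    proof (cases "u = 0 \<or> u = l")
      case False
      then show ?thesis using u le_binomial[of u l] by (auto simp: field_simps)
    qed auto
  qed
  also have "\<dots> = 2 + real (Suc l) / real l" by (simp add: sum.distrib)
  also have "\<dots> \<le> 4" using False by (simp add: field_simps)
  finally show ?thesis .
qed simp

lemma fact_mult_le: "fact m * fact n \<le> (fact (m + n) :: real)"
proof -
  have "fact m * fact n \<le> (fact (m + n) :: nat)"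
    by (intro dvd_imp_le fact_fact_dvd_fact) auto
  then have "real (fact m * fact n) \<le> real (fact (m + n))"
    by (simp only: of_nat_le_iff)
  then show ?thesis by simp
qed

lemma binomial_pred_le: "(n - 1) choose (k - 1) \<le> n choose k" if "1 \<le> n" "1 \<le> k"
  using that by (cases n; cases k) auto

text \<open>The binomials cancel one copy of most factorials and leave \<open>u! (l - u)!\<close>,
  which is \<open>l!\<close> divided by a binomial, times \<open>(f + u)! (l - u - f)!\<close>,
  which is at most \<open>l!\<close>. The surviving inverse binomial makes the sum over
  \<open>u\<close> bounded.\<close>

lemma binomial_coeff_bound:
  assumes "1 \<le> f" "f \<le> l" "u \<le> l - f"
  shows "(fact f)\<^sup>2 * real ((l - u) choose f) * real ((f + u) choose f) * (fact u)\<^sup>2 * (fact (l - u - f))\<^sup>2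
    \<le> (fact l)\<^sup>2 / real (l choose u)"
proof -
  have 1: "fact f * fact (l - u - f) * real ((l - u) choose f) = fact (l - u)"
    using assms by (subst binomial_fact) auto
  have 2: "fact f * fact u * real ((f + u) choose f) = fact (f + u)"
    by (subst binomial_fact) auto
  have 3: "fact u * fact (l - u) = fact l / real (l choose u)"
    using assms by (subst binomial_fact) auto
  have "fact (f + u) * fact (l - u - f) \<le> (fact (f + u + (l - u - f)) :: real)"
    by (rule fact_mult_le)
  also have "f + u + (l - u - f) = l" using assms by simp
  finally have 4: "fact (f + u) * fact (l - u - f) \<le> (fact l :: real)" .
  have "(fact f)\<^sup>2 * real ((l - u) choose f) * real ((f + u) choose f) * (fact u)\<^sup>2 * (fact (l - u - f))\<^sup>2
     = (fact f * fact (l - u - f) * real ((l - u) choose f)) * (fact f * fact u * real ((f + u) choose f)) * (fact u * fact (l - u - f))"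
    by (simp add: power2_eq_square algebra_simps)
  also have "\<dots> = (fact u * fact (l - u)) * (fact (f + u) * fact (l - u - f))"
    unfolding 1 2 by simp
  also have "\<dots> \<le> (fact u * fact (l - u)) * fact l"
    by (intro mult_left_mono 4) auto
  finally show ?thesis unfolding 3 by (simp add: power2_eq_square)
qed

text \<open>Summing over \<open>r\<close> closes the induction: once the two binomials are replaced
  by bounds free of \<open>r\<close> and \<open>v\<close>, both inner sums become row sums
  \<open>T\<close> of smaller index. The factorials are absorbed by
  \<open>binomial_coeff_bound\<close>, and the sum over \<open>u\<close> costs the factor 4.\<close>

lemma S_rec_sum_bound:
  assumes p: "0 < p" and \<alpha>: "0 \<le> \<alpha>" "\<alpha> \<le> 1" and X: "\<And>f. 0 \<le> X (2 * f)"
    and K: "0 < K" "\<And>f. 1 \<le> f \<Longrightarrow> X (2 * f) \<le> K ^ f * (fact f)\<^sup>2"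
  shows "(\<Sum>r\<le>l. S_rec p \<alpha> X b l r) \<le> (K * (1 + 4 * p)) ^ l * (fact l)\<^sup>2"
proof (induction l arbitrary: b rule: less_induct)
  case (less l)
  define B where "B = K * (1 + 4 * p)"
  have B: "0 < B" using K p by (simp add: B_def)
  define T where "T b l = (\<Sum>r\<le>l. S_rec p \<alpha> X b l r)" for b l
  note nn = S_rec_nonneg[of p \<alpha> X, OF less_imp_le[OF p] \<alpha> X]
  have Tnn: "0 \<le> T b l" for b l unfolding T_def by (intro sum_nonneg nn)
  show ?case
  proof (cases "l = 0")
    case True
    then show ?thesis using \<alpha> by (simp add: S_rec_at_0)
  next
    case False
    define c where "c f u = K ^ f * (fact f)\<^sup>2 * real ((l - u) choose f) * real ((f + u) choose f) * T (\<not> b) u" for f u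
    have cnn: "0 \<le> c f u" for f u unfolding c_def using K Tnn by (intro mult_nonneg_nonneg) auto
    \<comment> \<open>Extension by zero makes the ranges of \<open>f\<close> and \<open>u\<close>
      independent of \<open>r\<close>, so that the sum over \<open>r\<close> can be moved
      inside.\<close>
    define s where "s f u r = (if f \<le> r \<and> u \<le> l - r then S_rec p \<alpha> X b (l - u - f) (r - f) else 0)" for f u r
    have snn: "0 \<le> s f u r" for f u r unfolding s_def using nn by auto
    have term_le: "S_rec p \<alpha> X b l r \<le> p * (\<Sum>f = 1..l. \<Sum>u\<le>l - f. c f u * s f u r)" if r: "r \<le> l" for r
    proof (cases "r = 0")
      case True
      then have "S_rec p \<alpha> X b l r = 0" using False by (simp add: S_rec_at_0)
      also have "0 \<le> p * (\<Sum>f = 1..l. \<Sum>u\<le>l - f. c f u * s f u r)"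
        using p cnn snn by (intro mult_nonneg_nonneg sum_nonneg) auto
      finally show ?thesis .
    next
      case r0: False
      have "(\<Sum>f = 1..r. real ((r - 1) choose (f - 1)) * X (2 * f) *
            (\<Sum>u = 0..l - r. S_rec p \<alpha> X b (l - u - f) (r - f) *
               (\<Sum>v = 0..u. real ((f + v - 1) choose (f - 1)) * S_rec p \<alpha> X (\<not> b) u v)))
          \<le> (\<Sum>f = 1..r. \<Sum>u\<le>l - f. c f u * s f u r)"
      proof (rule sum_mono)
        fix f assume f: "f \<in> {1..r}"
        have "real ((r - 1) choose (f - 1)) * X (2 * f) *
            (\<Sum>u = 0..l - r. S_rec p \<alpha> X b (l - u - f) (r - f) *
               (\<Sum>v = 0..u. real ((f + v - 1) choose (f - 1)) * S_rec p \<alpha> X (\<not> b) u v))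
          = (\<Sum>u = 0..l - r. real ((r - 1) choose (f - 1)) * X (2 * f) *
             (S_rec p \<alpha> X b (l - u - f) (r - f) *
               (\<Sum>v = 0..u. real ((f + v - 1) choose (f - 1)) * S_rec p \<alpha> X (\<not> b) u v)))"
          by (simp add: sum_distrib_left)
        also have "\<dots> \<le> (\<Sum>u = 0..l - r. c f u * s f u r)"
        proof (rule sum_mono)
          fix u assume u: "u \<in> {0..l - r}"
          have "(\<Sum>v = 0..u. real ((f + v - 1) choose (f - 1)) * S_rec p \<alpha> X (\<not> b) u v)
              \<le> (\<Sum>v = 0..u. real ((f + u) choose f) * S_rec p \<alpha> X (\<not> b) u v)"
          proof (intro sum_mono mult_right_mono nn)
            fix v assume "v \<in> {0..u}"
            then have "(f + v - 1) choose (f - 1) \<le> (f + u) choose f"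
              using binomial_pred_le[of "f + v" f] binomial_right_mono[of "f + v" "f + u" f] f
              by (auto intro: order_trans)
            then show "real ((f + v - 1) choose (f - 1)) \<le> real ((f + u) choose f)" by simp
          qed
          also have "\<dots> = real ((f + u) choose f) * T (\<not> b) u"
            by (simp add: T_def sum_distrib_left atMost_atLeast0)
          finally have v: "(\<Sum>v = 0..u. real ((f + v - 1) choose (f - 1)) * S_rec p \<alpha> X (\<not> b) u v)
              \<le> real ((f + u) choose f) * T (\<not> b) u" .
          have "(r - 1) choose (f - 1) \<le> (l - u) choose f"
            using binomial_pred_le[of r f] binomial_right_mono[of r "l - u" f] f u r
            by (auto intro: order_trans)
          then have "real ((r - 1) choose (f - 1)) * X (2 * f) \<le> real ((l - u) choose f) * (K ^ f * (fact f)\<^sup>2)"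
            using K(2)[of f] X f by (intro mult_mono) auto
          then have "real ((r - 1) choose (f - 1)) * X (2 * f) *
             (S_rec p \<alpha> X b (l - u - f) (r - f) *
               (\<Sum>v = 0..u. real ((f + v - 1) choose (f - 1)) * S_rec p \<alpha> X (\<not> b) u v))
             \<le> real ((l - u) choose f) * (K ^ f * (fact f)\<^sup>2) * (S_rec p \<alpha> X b (l - u - f) (r - f) * (real ((f + u) choose f) * T (\<not> b) u))"
            by (rule mult_mono) (use v nn K in \<open>auto intro!: mult_nonneg_nonneg sum_nonneg mult_left_mono\<close>)
          also have "\<dots> = c f u * s f u r"
            using f u by (simp add: c_def s_def)
          finally show "real ((r - 1) choose (f - 1)) * X (2 * f) *
             (S_rec p \<alpha> X b (l - u - f) (r - f) *
               (\<Sum>v = 0..u. real ((f + v - 1) choose (f - 1)) * S_rec p \<alpha> X (\<not> b) u v)) \<le> c f u * s f u r" .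
        qed
        also have "\<dots> \<le> (\<Sum>u\<le>l - f. c f u * s f u r)"
          using f r by (intro sum_mono2 mult_nonneg_nonneg cnn snn) auto
        finally show "real ((r - 1) choose (f - 1)) * X (2 * f) *
            (\<Sum>u = 0..l - r. S_rec p \<alpha> X b (l - u - f) (r - f) *
               (\<Sum>v = 0..u. real ((f + v - 1) choose (f - 1)) * S_rec p \<alpha> X (\<not> b) u v))
           \<le> (\<Sum>u\<le>l - f. c f u * s f u r)" .
      qed
      also have "\<dots> \<le> (\<Sum>f = 1..l. \<Sum>u\<le>l - f. c f u * s f u r)"
        using r by (intro sum_mono2 sum_nonneg mult_nonneg_nonneg cnn snn) auto
      finally show ?thesis
        using r0 r p by (simp add: S_rec_unfold)
    qed
    have sT: "(\<Sum>r\<le>l. s f u r) = T b (l - u - f)" if "f \<in> {1..l}" "u \<le> l - f" for f u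
    proof -
      have "(\<Sum>r\<le>l. s f u r) = (\<Sum>r\<in>{f..l - u}. S_rec p \<alpha> X b (l - u - f) (r - f))"
        using that by (intro sum.mono_neutral_cong_right) (auto simp: s_def)
      also have "\<dots> = T b (l - u - f)"
        unfolding T_def using that
        by (intro sum.reindex_bij_witness[of _ "\<lambda>r. r + f" "\<lambda>r. r - f"]) auto
      finally show ?thesis .
    qed
    have "(\<Sum>r\<le>l. S_rec p \<alpha> X b l r) \<le> (\<Sum>r\<le>l. p * (\<Sum>f = 1..l. \<Sum>u\<le>l - f. c f u * s f u r))"
      by (intro sum_mono term_le) auto
    also have "\<dots> = p * (\<Sum>f = 1..l. \<Sum>u\<le>l - f. c f u * (\<Sum>r\<le>l. s f u r))"
      by (simp add: sum_distrib_left sum.swap[of _ "{..l}"] mult.assoc)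
    also have "\<dots> = p * (\<Sum>f = 1..l. \<Sum>u\<le>l - f. c f u * T b (l - u - f))"
      by (simp add: sT)
    also have "\<dots> \<le> p * (\<Sum>f = 1..l. \<Sum>u\<le>l - f. K ^ f * B ^ (l - f) * (fact l)\<^sup>2 * (1 / real (l choose u)))"
    proof (intro mult_left_mono sum_mono)
      fix f u assume fu: "f \<in> {1..l}" "u \<in> {..l - f}"
      have "c f u * T b (l - u - f) \<le> K ^ f * (fact f)\<^sup>2 * real ((l - u) choose f) * real ((f + u) choose f)
              * (B ^ u * (fact u)\<^sup>2) * (B ^ (l - u - f) * (fact (l - u - f))\<^sup>2)"
        unfolding c_def T_def B_def
        using fu K B nn by (intro mult_mono mult_left_mono less.IH mult_nonneg_nonneg sum_nonneg) (auto simp: B_def)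
      also have "\<dots> = K ^ f * (B ^ u * B ^ (l - u - f)) * ((fact f)\<^sup>2 * real ((l - u) choose f) * real ((f + u) choose f) * (fact u)\<^sup>2 * (fact (l - u - f))\<^sup>2)"
        by simp
      also have "\<dots> \<le> K ^ f * (B ^ u * B ^ (l - u - f)) * ((fact l)\<^sup>2 / real (l choose u))"
        using fu K B by (intro mult_left_mono binomial_coeff_bound) auto
      also have "B ^ u * B ^ (l - u - f) = B ^ (l - f)"
        unfolding power_add[symmetric] using fu by (intro arg_cong[where f = "\<lambda>n. B ^ n"]) auto
      finally show "c f u * T b (l - u - f) \<le> K ^ f * B ^ (l - f) * (fact l)\<^sup>2 * (1 / real (l choose u))"
        by simp
    qed (use p in auto)
    also have "\<dots> = p * (\<Sum>f = 1..l. K ^ f * B ^ (l - f) * (fact l)\<^sup>2 * (\<Sum>u\<le>l - f. 1 / real (l choose u)))"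
      by (simp only: sum_distrib_left)
    also have "\<dots> \<le> p * (\<Sum>f = 1..l. K ^ f * B ^ (l - f) * (fact l)\<^sup>2 * 4)"
    proof (intro mult_left_mono sum_mono)
      fix f
      have "(\<Sum>u\<le>l - f. 1 / real (l choose u)) \<le> (\<Sum>u\<le>l. 1 / real (l choose u))"
        by (intro sum_mono2) auto
      then show "(\<Sum>u\<le>l - f. 1 / real (l choose u)) \<le> 4"
        using sum_inverse_binomial_le[of l] by linarith
    qed (use p K B in auto)
    also have "\<dots> = 4 * p * (fact l)\<^sup>2 * (\<Sum>f = 1..l. K ^ f * B ^ (l - f))"
      by (simp add: sum_distrib_left sum_distrib_right algebra_simps)
    also have "(\<Sum>f = 1..l. K ^ f * B ^ (l - f)) * (4 * p) \<le> B ^ l"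
    proof -
      \<comment> \<open>The value of \<open>B\<close> is chosen for this step:
        \<open>B - K = 4 * p * K\<close> makes the geometric sum telescope.\<close>
      have "(\<Sum>f = 1..n. K ^ f * B ^ (n - f)) * (4 * p) = B ^ n - K ^ n" for n
      proof (induction n)
        case (Suc n)
        have "(\<Sum>f = 1..Suc n. K ^ f * B ^ (Suc n - f)) = (\<Sum>f = 1..n. B * (K ^ f * B ^ (n - f))) + K ^ Suc n"
          by (auto simp: Suc_diff_le intro!: sum.cong)
        then have "(\<Sum>f = 1..Suc n. K ^ f * B ^ (Suc n - f)) * (4 * p)
           = B * ((\<Sum>f = 1..n. K ^ f * B ^ (n - f)) * (4 * p)) + K ^ n * (K * (4 * p))"
          by (simp add: sum_distrib_left algebra_simps)
        also have "\<dots> = B * (B ^ n - K ^ n) + K ^ n * (B - K)"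
          unfolding Suc by (simp add: B_def algebra_simps)
        finally show ?case by (simp add: algebra_simps)
      qed simp
      then show ?thesis using K by simp
    qed
    then have "4 * p * (fact l)\<^sup>2 * (\<Sum>f = 1..l. K ^ f * B ^ (l - f)) \<le> B ^ l * (fact l)\<^sup>2"
      by (simp add: algebra_simps)
    finally show ?thesis by (simp add: B_def)
  qed
qed

text \<open>\<open>m ^ m / m!\<close> is a single term of the exponential series at
  \<open>m\<close>.\<close>

lemma power_self_le_exp_fact: "real m ^ m \<le> exp 1 ^ m * fact m"
proof -
  have "real m ^ m / fact m \<le> exp (real m)"
  proof -
    have "(\<lambda>n. real m ^ n / fact n) sums exp (real m)"
      using exp_converges[of "real m"] by (simp add: field_simps)
    then show ?thesis
      using sum_le_suminf[of "\<lambda>n. real m ^ n / fact n" "{m}"] by (auto simp: sums_iff)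
  qed
  then show ?thesis by (simp add: field_simps exp_of_nat_mult[symmetric])
qed

lemma lim_moment_nonneg:
  assumes "0 \<le> p" "0 \<le> \<alpha>" "\<alpha> \<le> 1" "\<And>f. 0 \<le> X (2 * f)"
  shows "0 \<le> lim_moment p \<alpha> X k"
  unfolding lim_moment_def S1_def S2_def
  by (intro sum_nonneg add_nonneg_nonneg S_rec_nonneg assms)

text \<open>The growth hypothesis is traded for \<open>K ^ f * (f!)^2\<close> by
  \<open>m ^ m \<le> e ^ m * m!\<close>, and the resulting bound is traded back by
  \<open>k! \<le> k ^ k\<close>.\<close>

lemma lim_moment_growth:
  assumes "0 < p" "0 \<le> \<alpha>" "\<alpha> \<le> 1" "\<And>f. 0 \<le> X (2 * f)"
    and growth: "\<And>m. X (2 * m) \<le> (C * real m) ^ (2 * m)"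
  shows "\<exists>D>0. \<forall>k\<ge>1. lim_moment p \<alpha> X k \<le> (D * real k) ^ (2 * k)"
proof -
  \<comment> \<open>Only \<open>C^2\<close> enters, so the sign of \<open>C\<close> is irrelevant;
    adding 1 keeps \<open>K\<close> positive when \<open>C = 0\<close>.\<close>
  define K where "K = (C\<^sup>2 + 1) * (exp 1)\<^sup>2"
  have K: "0 < K" unfolding K_def by (intro mult_pos_pos) (auto simp: add_nonneg_pos)
  have XK: "X (2 * f) \<le> K ^ f * (fact f)\<^sup>2" for f
  proof -
    have "X (2 * f) \<le> (C * real f) ^ (2 * f)" by (rule growth)
    also have "\<dots> = (C\<^sup>2) ^ f * (real f ^ f)\<^sup>2"
      by (simp add: power_mult_distrib power_mult[symmetric] mult.commute)
    also have "\<dots> \<le> (C\<^sup>2 + 1) ^ f * (exp 1 ^ f * fact f)\<^sup>2"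
      by (intro mult_mono power_mono power_self_le_exp_fact) auto
    also have "\<dots> = K ^ f * (fact f)\<^sup>2"
      by (simp add: K_def power_mult_distrib power_mult[symmetric] mult.commute)
    finally show ?thesis .
  qed
  define B where "B = K * (1 + 4 * p)"
  have B: "0 < B" using K assms by (simp add: B_def)
  \<comment> \<open>For \<open>k \<ge> 1\<close> the factor 2 coming from the two families is at
    most \<open>2 ^ k\<close>; the square root adapts the base to the exponent
    \<open>2 * k\<close>.\<close>
  have "lim_moment p \<alpha> X k \<le> (sqrt (2 * B + 1) * real k) ^ (2 * k)" if k: "k \<ge> 1" for k
  proof -
    have "lim_moment p \<alpha> X k = (\<Sum>r\<le>k. S_rec p \<alpha> X True k r) + (\<Sum>r\<le>k. S_rec p \<alpha> X False k r)"
      by (simp add: lim_moment_def S1_def S2_def sum.distrib atMost_atLeast0)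
    also have "\<dots> \<le> B ^ k * (fact k)\<^sup>2 + B ^ k * (fact k)\<^sup>2"
      unfolding B_def using assms K XK by (intro add_mono S_rec_sum_bound) auto
    also have "\<dots> = 2 * B ^ k * (fact k)\<^sup>2" by simp
    also have "\<dots> \<le> 2 ^ k * B ^ k * (real k ^ k)\<^sup>2"
      using k B self_le_power[of "2::real" k] fact_le_power[of k]
      by (intro mult_mono power_mono) auto
    also have "\<dots> \<le> (2 * B + 1) ^ k * (real k ^ k)\<^sup>2"
      unfolding power_mult_distrib[symmetric] using B by (intro mult_right_mono power_mono) auto
    also have "(2 * B + 1) ^ k = sqrt (2 * B + 1) ^ (2 * k)"
      using B by (simp add: power_mult)
    also have "\<dots> * (real k ^ k)\<^sup>2 = (sqrt (2 * B + 1) * real k) ^ (2 * k)"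
      by (simp add: power_mult_distrib power_mult[symmetric] mult.commute)
    finally show ?thesis .
  qed
  moreover have "0 < sqrt (2 * B + 1)" using B by simp
  ultimately show ?thesis by blast
qed

text \<open>A bound \<open>(D * k) ^ (2 * k)\<close> on the moment bounds its Carleman term below by
  \<open>1 / (D * k)\<close>, and the harmonic series diverges. A vanishing moment contributes an
  infinite term by convention.\<close>

lemma carleman_lim_moment:
  assumes "0 < p" "0 \<le> \<alpha>" "\<alpha> \<le> 1" "\<And>f. 0 \<le> X (2 * f)"
    and growth: "\<And>m. X (2 * m) \<le> (C * real m) ^ (2 * m)"
  shows "(\<Sum>k. carleman_term (lim_moment p \<alpha> X (Suc k)) (Suc k)) = \<infinity>"
proof -
  obtain D where D: "D > 0" "\<And>k. k \<ge> 1 \<Longrightarrow> lim_moment p \<alpha> X k \<le> (D * real k) ^ (2 * k)"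
    using lim_moment_growth[of p \<alpha> X C, OF assms] by blast
  have le: "ennreal (inverse D * inverse (real (Suc k))) \<le> carleman_term (lim_moment p \<alpha> X (Suc k)) (Suc k)" for k
  proof (cases "lim_moment p \<alpha> X (Suc k) = 0")
    case False
    let ?m = "lim_moment p \<alpha> X (Suc k)"
    have m: "0 < ?m" using False lim_moment_nonneg[of p \<alpha> X "Suc k"] assms by force
    have "((D * real (Suc k)) ^ (2 * Suc k)) powr (- 1 / (2 * real (Suc k))) \<le> ?m powr (- 1 / (2 * real (Suc k)))"
      using D(2)[of "Suc k"] m by (intro powr_mono2') auto
    also have "((D * real (Suc k)) ^ (2 * Suc k)) powr (- 1 / (2 * real (Suc k)))
        = ((D * real (Suc k)) powr real (2 * Suc k)) powr (- 1 / (2 * real (Suc k)))"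
      using D(1) by (subst powr_realpow) auto
    also have "\<dots> = (D * real (Suc k)) powr (- 1)"
      unfolding powr_powr by (rule arg_cong2[where f = "(powr)"]) (auto simp: field_simps)
    also have "\<dots> = inverse D * inverse (real (Suc k))"
      using D(1) by (simp add: powr_minus)
    finally show ?thesis using False by (simp add: carleman_term_def ennreal_leI)
  qed (simp add: carleman_term_def)
  have "\<not> summable (\<lambda>k. inverse D * inverse (real (Suc k)))"
    using not_summable_harmonic[where 'a = real] D(1) summable_Suc_iff[of "\<lambda>k. inverse (real k)"]
    by (subst summable_cmult_iff) auto
  then have *: "(\<Sum>k. ennreal (inverse D * inverse (real (Suc k)))) = \<infinity>"
    using summable_suminf_not_top[of "\<lambda>k. inverse D * inverse (real (Suc k))"] D(1)
    unfolding infinity_ennreal_def by (meson inverse_nonnegative_iff_nonnegative less_imp_le mult_nonneg_nonneg of_nat_0_le_iff)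
  have "(\<Sum>k. ennreal (inverse D * inverse (real (Suc k))))
      \<le> (\<Sum>k. carleman_term (lim_moment p \<alpha> X (Suc k)) (Suc k))"
    by (rule suminf_le[OF le]) auto
  then show ?thesis unfolding * by (simp only: top_unique infinity_ennreal_def)
qed

subsection \<open>Edges and vertices of walks\<close>

text \<open>An undirected edge is stored with its smaller end first, so that equal edges are equal
  pairs and an edge is an index of one of the independent entries \<open>a i j\<close> with
  \<open>i \<le> j\<close>.\<close>

definition edge :: "nat \<Rightarrow> nat \<Rightarrow> nat \<times> nat" where
  "edge x y = (min x y, max x y)"

fun path_edges :: "nat list \<Rightarrow> (nat \<times> nat) list" where
  "path_edges (x # y # zs) = edge x y # path_edges (y # zs)"
| "path_edges _ = []"

definition ends :: "nat \<times> nat \<Rightarrow> nat set" where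
  "ends e = {fst e, snd e}"

lemma edge_commute: "edge x y = edge y x"
  by (simp add: edge_def min.commute max.commute)

lemma ends_edge [simp]: "ends (edge x y) = {x, y}"
  by (auto simp: ends_def edge_def min_def max_def)

lemma edge_eq_iff: "edge x y = edge x' y' \<longleftrightarrow> (x = x' \<and> y = y') \<or> (x = y' \<and> y = x')"
  by (auto simp: edge_def min_def max_def split: if_splits)

lemma length_path_edges: "length (path_edges w) = length w - 1"
  by (induction w rule: path_edges.induct) auto

lemma path_edges_append: "path_edges (u @ x # v) = path_edges (u @ [x]) @ path_edges (x # v)"
proof (induction u)
  case (Cons a u)
  then show ?case by (cases u) auto
qed simp

lemma path_edges_Cons: "w \<noteq> [] \<Longrightarrow> path_edges (x # w) = edge x (hd w) # path_edges w"
  by (cases w) auto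

lemma path_edges_snoc: "w \<noteq> [] \<Longrightarrow> path_edges (w @ [x]) = path_edges w @ [edge (last w) x]"
proof (induction w)
  case (Cons a w)
  then show ?case by (cases w) auto
qed simp

lemma set_path_edges_rev: "set (path_edges (rev w)) = set (path_edges w)"
proof (induction w)
  case (Cons a w)
  then show ?case
    by (cases "w = []") (auto simp: path_edges_Cons path_edges_snoc last_rev edge_commute)
qed simp

lemma ends_path_edges: "e \<in> set (path_edges w) \<Longrightarrow> ends e \<subseteq> set w"
  by (induction w rule: path_edges.induct) auto

lemma Union_ends_path_edges: "\<Union> (ends ` set (path_edges w)) \<subseteq> set w"
  using ends_path_edges by blast

lemma ends_nonempty [simp]: "ends e \<noteq> {}"
  by (simp add: ends_def)

lemma path_edges_range: "e \<in> set (path_edges w) \<Longrightarrow> fst e \<le> snd e"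
  by (induction w rule: path_edges.induct) (auto simp: edge_def)

text \<open>A step to a vertex outside \<open>V\<close> uses an edge outside \<open>E\<close>, since
  all edges of \<open>E\<close> have their ends in \<open>V\<close>. Hence vertices minus edges
  never increases along the path. Every estimate in powers of \<open>N\<close> rests on
  this.\<close>

lemma card_attach_path_hd:
  assumes "finite E" "finite V" "\<Union> (ends ` E) \<subseteq> V" "w \<noteq> []" "hd w \<in> V"
  shows "card (V \<union> set w) + card E \<le> card (E \<union> set (path_edges w)) + card V"
  using assms
proof (induction w arbitrary: E V rule: path_edges.induct)
  case (1 x y zs)
  let ?E = "insert (edge x y) E" and ?V = "insert y V"
  have "card (?V \<union> set (y # zs)) + card ?E \<le> card (?E \<union> set (path_edges (y # zs))) + card ?V"
    using 1 by (intro "1.IH") auto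
  moreover have "?V \<union> set (y # zs) = V \<union> set (x # y # zs)"
    "?E \<union> set (path_edges (y # zs)) = E \<union> set (path_edges (x # y # zs))"
    using 1 by auto
  moreover have "card ?V + card E \<le> card ?E + card V"
  proof (cases "y \<in> V")
    case True
    then have "?V = V" by auto
    then show ?thesis using 1 by (simp add: card_insert_if)
  next
    case False
    then have "edge x y \<notin> E" using 1(4) by force
    then show ?thesis using 1 False by simp
  qed
  ultimately show ?case by simp
next
  case ("2_2" v)
  then have "V \<union> set [v] = V" by auto
  then show ?case by simp
qed auto

text \<open>Cut the path at a vertex of \<open>V\<close>: the first piece, reversed, and the second
  piece both start in the graph built so far.\<close>

lemma card_attach_path:
  assumes "finite E" "finite V" "\<Union> (ends ` E) \<subseteq> V" "set w \<inter> V \<noteq> {}"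
  shows "card (V \<union> set w) + card E \<le> card (E \<union> set (path_edges w)) + card V"
proof -
  obtain x u v where x: "x \<in> V" and w: "w = u @ x # v"
    using assms(4) by (meson disjoint_iff split_list)
  let ?E = "E \<union> set (path_edges (u @ [x]))" and ?V = "V \<union> set (u @ [x])"
  have "card ?V + card E \<le> card ?E + card V"
    using card_attach_path_hd[of E V "rev (u @ [x])"] assms x
    by (simp add: set_path_edges_rev[of "u @ [x]", simplified])
  moreover have "card (?V \<union> set (x # v)) + card ?E \<le> card (?E \<union> set (path_edges (x # v))) + card ?V"
    using assms x Union_ends_path_edges[of "u @ [x]"] by (intro card_attach_path_hd) auto
  moreover have "?V \<union> set (x # v) = V \<union> set w" "?E \<union> set (path_edges (x # v)) = E \<union> set (path_edges w)"
    unfolding w path_edges_append[of u x v] by auto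
  ultimately show ?thesis by simp
qed

lemma card_path_le: "w \<noteq> [] \<Longrightarrow> card (set w) \<le> Suc (card (set (path_edges w)))"
  using card_attach_path_hd[of "{}" "{hd w}" w] by (simp add: insert_absorb)

lemma card_two_paths_le:
  assumes "set w \<inter> set w' \<noteq> {}"
  shows "card (set w \<union> set w') \<le> Suc (card (set (path_edges w) \<union> set (path_edges w')))"
proof -
  have "w \<noteq> []" using assms by auto
  then show ?thesis
    using card_attach_path[of "set (path_edges w)" "set w" w'] card_path_le[of w] assms
      Union_ends_path_edges[of w]
    by (simp add: Int_commute)
qed

text \<open>The path \<open>q\<close> has at least as many edges as vertices less one, and
  \<open>x\<close> is joined to it by two different new edges; this is where a cycle gains an
  edge.\<close>

lemma card_open_loop_le:
  assumes "x \<notin> set q" "q \<noteq> []" "hd q \<noteq> last q"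
  shows "card (set (x # q)) \<le> card (set (path_edges (x # q @ [x])))"
proof -
  have "set (path_edges (x # q @ [x])) = {edge x (hd q), edge x (last q)} \<union> set (path_edges q)"
    using assms by (simp add: path_edges_Cons path_edges_snoc edge_commute)
  moreover have "edge x (hd q) \<notin> set (path_edges q)" "edge x (last q) \<notin> set (path_edges q)"
    using assms ends_path_edges[of _ q] by fastforce+
  moreover have "edge x (hd q) \<noteq> edge x (last q)"
    using assms by (simp add: edge_eq_iff)
  ultimately have "card (set (path_edges (x # q @ [x]))) = card (set (path_edges q)) + 2"
    by simp
  then show ?thesis using card_path_le[of q] assms by simp
qed

text \<open>The open loop already has as many edges as vertices, and attaching the whole walk at
  \<open>x\<close> preserves this.\<close>

lemma card_walk_with_open_loop_le:
  assumes "w \<noteq> []" "hd w = x" "set (path_edges (x # q @ [x])) \<subseteq> set (path_edges w)" "set (x # q) \<subseteq> set w"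
    "x \<notin> set q" "q \<noteq> []" "hd q \<noteq> last q"
  shows "card (set w) \<le> card (set (path_edges w))"
proof -
  have "card (set (x # q) \<union> set w) + card (set (path_edges (x # q @ [x])))
      \<le> card (set (path_edges (x # q @ [x])) \<union> set (path_edges w)) + card (set (x # q))"
    using assms Union_ends_path_edges[of "x # q @ [x]"] by (intro card_attach_path_hd) auto
  moreover have "set (x # q) \<union> set w = set w"
    "set (path_edges (x # q @ [x])) \<union> set (path_edges w) = set (path_edges w)"
    using assms by auto
  ultimately show ?thesis using card_open_loop_le[of x q] assms by simp
qed

section \<open>Words weighted by their number of distinct letters\<close>

definition words :: "nat set \<Rightarrow> nat \<Rightarrow> nat list set" where
  "words D n = {w. set w \<subseteq> D \<and> length w = n}"

lemma finite_words [simp]: "finite D \<Longrightarrow> finite (words D n)"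
  unfolding words_def by (rule finite_lists_length_eq)

lemma sum_words_Suc:
  "(\<Sum>w\<in>words D (Suc n). g w) = (\<Sum>w\<in>words D n. \<Sum>x\<in>D. g (x # w))"
proof -
  have "(\<Sum>w\<in>words D (Suc n). g w) = (\<Sum>(w, x)\<in>words D n \<times> D. g (x # w))"
    by (rule sum.reindex_bij_witness[of _ "\<lambda>(w, x). x # w" "\<lambda>w. (tl w, hd w)"])
      (auto simp: words_def length_Suc_conv)
  then show ?thesis by (simp add: sum.cartesian_product)
qed

text \<open>A further letter either repeats one of at most \<open>n\<close> earlier letters and
  keeps the weight, or is one of at most \<open>N\<close> new letters, each at the cost of
  \<open>1 / N\<close>. So every extension multiplies the sum by at most \<open>n + 1\<close>,
  whatever \<open>N\<close> is.\<close>

lemma sum_words_card_le: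
  assumes N: "0 < N"
  shows "(\<Sum>w\<in>words {..<N} n. (1 / real N) ^ card (set w)) \<le> fact n"
proof (induction n)
  case 0
  have "words {..<N} 0 = {[]}" by (auto simp: words_def)
  then show ?case by simp
next
  case (Suc n)
  have "(\<Sum>x<N. (1 / real N) ^ card (set (x # w))) \<le> real (Suc n) * (1 / real N) ^ card (set w)"
    if w: "w \<in> words {..<N} n" for w
  proof -
    have "(\<Sum>x<N. (1 / real N) ^ card (set (x # w)))
        \<le> (\<Sum>x<N. (if x \<in> set w then (1 / real N) ^ card (set w) else 0) + (1 / real N) ^ Suc (card (set w)))"
      using N by (intro sum_mono) (auto simp: card_insert_if)
    also have "\<dots> = real (card (set w)) * (1 / real N) ^ card (set w) + (1 / real N) ^ card (set w)"
    proof -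
      have "{..<N} \<inter> set w = set w" using w by (auto simp: words_def)
      then show ?thesis using N by (simp add: sum.distrib sum.If_cases Int_def[symmetric])
    qed
    also have "\<dots> \<le> real n * (1 / real N) ^ card (set w) + (1 / real N) ^ card (set w)"
      using w card_length[of w] by (intro add_right_mono mult_right_mono) (auto simp: words_def)
    finally show ?thesis by (simp add: algebra_simps)
  qed
  then have "(\<Sum>w\<in>words {..<N} (Suc n). (1 / real N) ^ card (set w))
      \<le> (\<Sum>w\<in>words {..<N} n. real (Suc n) * (1 / real N) ^ card (set w))"
    unfolding sum_words_Suc by (intro sum_mono) 
  also have "\<dots> \<le> real (Suc n) * fact n"
    unfolding sum_distrib_left[symmetric] by (intro mult_left_mono Suc) auto
  finally show ?case by simp
qed

subsection \<open>Closed walks as sequences of loops\<close>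

definition edge_prod :: "(nat \<Rightarrow> nat \<Rightarrow> real) \<Rightarrow> (nat \<times> nat) list \<Rightarrow> real" where
  "edge_prod A es = (\<Prod>e\<leftarrow>es. A (fst e) (snd e))"

lemma edge_prod_simps [simp]:
  "edge_prod A [] = 1"
  "edge_prod A (e # es) = A (fst e) (snd e) * edge_prod A es"
  "edge_prod A (es @ fs) = edge_prod A es * edge_prod A fs"
  by (simp_all add: edge_prod_def)

text \<open>A closed walk based at \<open>i\<close> is encoded by the list of the vertex sequences strictly between
  successive visits to \<open>i\<close>.\<close>

definition loop_edges :: "nat \<Rightarrow> nat list \<Rightarrow> (nat \<times> nat) list" where
  "loop_edges i q = path_edges (i # q @ [i])"

text \<open>A loop with interior \<open>q\<close> has \<open>Suc (length q)\<close> edges, so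
  \<open>n\<close> is the length of the walk and \<open>r\<close> its number of returns. An empty
  interior stands for a step from the base point to itself.\<close>

definition loops :: "nat set \<Rightarrow> nat \<Rightarrow> nat \<Rightarrow> nat list list set" where
  "loops D n r = {ls. length ls = r \<and> (\<forall>q\<in>set ls. set q \<subseteq> D) \<and> (\<Sum>q\<leftarrow>ls. Suc (length q)) = n}"

text \<open>The final return to \<open>i\<close> is left out so that loops can be concatenated; the
  closed walk is \<open>walk i ls @ [i]\<close>.\<close>

definition walk :: "nat \<Rightarrow> nat list list \<Rightarrow> nat list" where
  "walk i ls = concat (map ((#) i) ls)"

definition walk_edges :: "nat \<Rightarrow> nat list list \<Rightarrow> (nat \<times> nat) list" where
  "walk_edges i ls = concat (map (loop_edges i) ls)"

lemma walk_simps [simp]: "walk i [] = []" "walk i (q # ls) = i # q @ walk i ls"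
  by (simp_all add: walk_def)

lemma walk_edges_simps [simp]:
  "walk_edges i [] = []" "walk_edges i (q # ls) = loop_edges i q @ walk_edges i ls"
  by (simp_all add: walk_edges_def)

lemma walk_hd: "ls \<noteq> [] \<Longrightarrow> hd (walk i ls) = i"
  by (cases ls) auto

lemma walk_snoc_cases: "walk i ls @ [i] = i # tl (walk i ls @ [i])"
  by (cases ls) auto

lemma path_edges_walk: "path_edges (walk i ls @ [i]) = walk_edges i ls"
proof (induction ls)
  case (Cons q ls)
  have "path_edges ((i # q) @ i # tl (walk i ls @ [i]))
      = path_edges (i # q @ [i]) @ path_edges (i # tl (walk i ls @ [i]))"
    by (subst path_edges_append) simp
  then show ?case
    using Cons by (simp add: walk_snoc_cases[symmetric] loop_edges_def del: path_edges.simps)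
qed simp

lemma length_walk: "ls \<in> loops D n r \<Longrightarrow> length (walk i ls) = n"
  unfolding walk_def length_concat by (simp add: loops_def comp_def)

lemma set_walk: "set (walk i ls) = (if ls = [] then {} else insert i (\<Union> (set ` set ls)))"
  by (induction ls) auto

lemma finite_loops [simp]:
  assumes "finite D"
  shows "finite (loops D n r)"
proof (rule finite_subset)
  show "loops D n r \<subseteq> {ls. set ls \<subseteq> (\<Union>k\<le>n. words D k) \<and> length ls = r}"
  proof
    fix ls assume "ls \<in> loops D n r"
    moreover have "length q \<le> (\<Sum>q\<leftarrow>ls. Suc (length q))" if "q \<in> set ls" for q
      using that by (induction ls) auto
    ultimately show "ls \<in> {ls. set ls \<subseteq> (\<Union>k\<le>n. words D k) \<and> length ls = r}"
      by (auto simp: loops_def words_def)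
  qed
  show "finite {ls. set ls \<subseteq> (\<Union>k\<le>n. words D k) \<and> length ls = r}"
    using assms by (intro finite_lists_length_eq) auto
qed

lemma loops_length_le: "ls \<in> loops D n r \<Longrightarrow> r \<le> n"
proof -
  have "length ls \<le> (\<Sum>q\<leftarrow>ls. Suc (length q))" by (induction ls) auto
  then show "ls \<in> loops D n r \<Longrightarrow> r \<le> n" by (simp add: loops_def)
qed

lemma loops_0: "loops D n 0 = (if n = 0 then {[]} else {})"
  by (auto simp: loops_def)

text \<open>The interior of the leading loop is recovered as the longest block after the initial
  \<open>i\<close> that avoids \<open>i\<close>.\<close>

lemma inj_on_walk: "inj_on (walk i) {ls. \<forall>q\<in>set ls. i \<notin> set q}"
proof -
  have first: "takeWhile (\<lambda>x. x \<noteq> i) (q @ walk i ls) = q" if "i \<notin> set q" for q ls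
    using that by (cases ls) (auto simp: takeWhile_append)
  have "ls = ls'" if "\<forall>q\<in>set ls. i \<notin> set q" "\<forall>q\<in>set ls'. i \<notin> set q" "walk i ls = walk i ls'" for ls ls'
    using that
  proof (induction ls arbitrary: ls')
    case Nil
    then show ?case by (cases ls') auto
  next
    case (Cons q ls)
    then obtain q' ls'' where ls': "ls' = q' # ls''" by (cases ls') auto
    then have "q @ walk i ls = q' @ walk i ls''" using Cons by simp
    moreover from this have "q = q'"
      using first[of q ls] first[of q' ls''] Cons.prems ls' by simp
    moreover have "ls = ls''" if "walk i ls = walk i ls''"
      using that Cons.prems ls' by (intro Cons.IH) auto
    ultimately show ?case using ls' by simp
  qed
  then show ?thesis by (auto simp: inj_on_def)
qed

lemma ex_walk:
  assumes "w = [] \<or> hd w = i" "set w \<subseteq> insert i D"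
  shows "\<exists>ls. walk i ls = w \<and> (\<forall>q\<in>set ls. set q \<subseteq> D)"
  using assms
proof (induction "length w" arbitrary: w rule: less_induct)
  case less
  show ?case
  proof (cases w)
    case Nil
    then show ?thesis by (intro exI[of _ "[]"]) auto
  next
    case (Cons x t)
    let ?q = "takeWhile (\<lambda>x. x \<noteq> i) t" and ?t = "dropWhile (\<lambda>x. x \<noteq> i) t"
    have "?t = [] \<or> hd ?t = i" using hd_dropWhile[of "\<lambda>x. x \<noteq> i" t] by auto
    moreover have "length ?t < length w" using Cons length_dropWhile_le[of "\<lambda>x. x \<noteq> i" t] by simp
    moreover have "set ?t \<subseteq> insert i D" using less.prems Cons set_dropWhileD by fastforce
    ultimately obtain ls where "walk i ls = ?t" "\<forall>q\<in>set ls. set q \<subseteq> D"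
      using less.hyps by blast
    moreover have "set ?q \<subseteq> D" using less.prems Cons by (auto dest!: set_takeWhileD)
    ultimately show ?thesis
      using less.prems Cons by (intro exI[of _ "?q # ls"]) auto
  qed
qed

lemma sum_closed_words:
  assumes "finite D" "i \<notin> D"
  shows "(\<Sum>w\<in>{w \<in> words (insert i D) n. w = [] \<or> hd w = i}. g w) = (\<Sum>r\<le>n. \<Sum>ls\<in>loops D n r. g (walk i ls))"
proof -
  have inj: "inj_on (walk i) (\<Union>r\<le>n. loops D n r)"
    by (rule inj_on_subset[OF inj_on_walk]) (use assms in \<open>auto simp: loops_def\<close>)
  have img: "{w \<in> words (insert i D) n. w = [] \<or> hd w = i} = walk i ` (\<Union>r\<le>n. loops D n r)"
  proof (intro subset_antisym subsetI)
    fix w assume w: "w \<in> {w \<in> words (insert i D) n. w = [] \<or> hd w = i}"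
    then obtain ls where ls: "walk i ls = w" "\<forall>q\<in>set ls. set q \<subseteq> D"
      using ex_walk[of w i D] by (auto simp: words_def)
    then have "ls \<in> loops D n (length ls)"
      using w length_concat[of "map ((#) i) ls"] by (auto simp: loops_def words_def walk_def comp_def)
    then show "w \<in> walk i ` (\<Union>r\<le>n. loops D n r)"
      using ls(1) loops_length_le[of ls D n] by (intro image_eqI[of _ _ ls]) auto
  next
    fix w assume "w \<in> walk i ` (\<Union>r\<le>n. loops D n r)"
    then obtain ls r where "w = walk i ls" "ls \<in> loops D n r" by auto
    then show "w \<in> {w \<in> words (insert i D) n. w = [] \<or> hd w = i}"
      using walk_hd[of ls i] length_walk[of ls D n r i]
      by (cases "ls = []") (auto simp: words_def set_walk loops_def)
  qed
  show ?thesis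
    unfolding img sum.reindex[OF inj] comp_def
    by (intro sum.UNION_disjoint ballI impI finite_loops assms) (auto simp: loops_def)
qed

section \<open>Generating series of loops and of sequences of loops\<close>

definition loop_fps :: "nat set \<Rightarrow> (nat list \<Rightarrow> real) \<Rightarrow> real fps" where
  "loop_fps D f = Abs_fps (\<lambda>n. case n of 0 \<Rightarrow> 0 | Suc m \<Rightarrow> (\<Sum>q\<in>words D m. f q))"

lemma loop_fps_0 [simp]: "fps_nth (loop_fps D f) 0 = 0"
  by (simp add: loop_fps_def)

lemma loop_fps_add: "loop_fps D (\<lambda>q. f q + g q) = loop_fps D f + loop_fps D g"
  by (rule fps_ext) (simp add: loop_fps_def sum.distrib split: nat.split)

lemma loop_fps_mult_loops:
  assumes "finite D"
  shows "loop_fps D f * Abs_fps (\<lambda>n. \<Sum>ls\<in>loops D n r. g ls)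
     = Abs_fps (\<lambda>n. \<Sum>ls\<in>loops D n (Suc r). f (hd ls) * g (tl ls))"
proof (rule fps_ext)
  fix n
  define Q where "Q k = {q. set q \<subseteq> D \<and> Suc (length q) = k}" for k
  have Q: "Q 0 = {}" "Q (Suc m) = words D m" for m by (auto simp: Q_def words_def)
  have finQ: "finite (Q k)" for k using assms by (cases k) (auto simp: Q)
  have nthQ: "fps_nth (loop_fps D f) k = (\<Sum>q\<in>Q k. f q)" for k
    by (auto simp: loop_fps_def Q split: nat.split)
  have "fps_nth (loop_fps D f * Abs_fps (\<lambda>n. \<Sum>ls\<in>loops D n r. g ls)) n
      = (\<Sum>k=0..n. \<Sum>(q, ls)\<in>Q k \<times> loops D (n - k) r. f q * g ls)"
    by (simp add: fps_mult_nth nthQ sum_product sum.cartesian_product)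
  also have "\<dots> = (\<Sum>(k, q, ls)\<in>(SIGMA k:{0..n}. Q k \<times> loops D (n - k) r). f q * g ls)"
    using finQ assms by (subst sum.Sigma) auto
  also have "\<dots> = (\<Sum>ls\<in>loops D n (Suc r). f (hd ls) * g (tl ls))"
    by (rule sum.reindex_bij_witness[of _ "\<lambda>ls. (Suc (length (hd ls)), hd ls, tl ls)" "\<lambda>(k, q, ls). q # ls"])
      (auto simp: loops_def Q_def length_Suc_conv)
  finally show "fps_nth (loop_fps D f * Abs_fps (\<lambda>n. \<Sum>ls\<in>loops D n r. g ls)) n
      = fps_nth (Abs_fps (\<lambda>n. \<Sum>ls\<in>loops D n (Suc r). f (hd ls) * g (tl ls))) n" by simp
qed

lemma loop_fps_power:
  assumes "finite D"
  shows "loop_fps D f ^ r = Abs_fps (\<lambda>n. \<Sum>ls\<in>loops D n r. \<Prod>q\<leftarrow>ls. f q)"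
proof (induction r)
  case 0
  show ?case by (rule fps_ext) (simp add: loops_0)
next
  case (Suc r)
  show ?case
    unfolding power_Suc Suc loop_fps_mult_loops[OF assms]
  proof (rule arg_cong[where f = Abs_fps], rule ext, rule sum.cong[OF refl])
    fix n ls assume "ls \<in> loops D n (Suc r)"
    then show "f (hd ls) * (\<Prod>q\<leftarrow>tl ls. f q) = (\<Prod>q\<leftarrow>ls. f q)" by (cases ls) (auto simp: loops_def)
  qed
qed

lemma loop_fps_mult_power:
  assumes "finite D"
  shows "fps_nth (loop_fps D f * loop_fps D g ^ r) n
     = (\<Sum>ls\<in>loops D n (Suc r). f (hd ls) * (\<Prod>q\<leftarrow>tl ls. g q))"
  unfolding loop_fps_power[OF assms] loop_fps_mult_loops[OF assms] by simp

text \<open>Multiplication by the all-ones series forms partial sums, which the hockey-stick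
  identity evaluates.\<close>

lemma geometric_fps_power:
  "Abs_fps (\<lambda>_. 1 :: real) ^ Suc k = Abs_fps (\<lambda>v. real ((k + v) choose k))"
proof (induction k)
  case (Suc k)
  show ?case
  proof (rule fps_ext)
    fix n
    have "fps_nth (Abs_fps (\<lambda>_. 1 :: real) ^ Suc (Suc k)) n = (\<Sum>v=0..n. real ((k + (n - v)) choose k))"
      unfolding power_Suc[of _ "Suc k"] Suc fps_mult_nth by simp
    also have "\<dots> = (\<Sum>v\<le>n. real ((k + v) choose k))"
      by (rule sum.reindex_bij_witness[of _ "\<lambda>v. n - v" "\<lambda>v. n - v"]) auto
    also have "\<dots> = real (\<Sum>v\<le>n. (k + v) choose v)"
      unfolding of_nat_sum
    proof (intro sum.cong refl)
      fix v show "real ((k + v) choose k) = real ((k + v) choose v)"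
        using binomial_symmetric[of k "k + v"] by simp
    qed
    also have "\<dots> = real ((Suc k + n) choose Suc k)"
      unfolding sum_choose_lower using binomial_symmetric[of n "Suc (k + n)"] by simp
    finally show "fps_nth (Abs_fps (\<lambda>_. 1 :: real) ^ Suc (Suc k)) n
      = fps_nth (Abs_fps (\<lambda>v. real ((Suc k + v) choose Suc k))) n" by simp
  qed
qed simp

text \<open>Both sides are coefficients of \<open>1 / (1 - L) ^ Suc k\<close>, obtained by composing
  the power of the geometric series with \<open>L\<close>. The truncation at
  \<open>v \<le> u\<close> is harmless because \<open>L ^ v\<close> starts in degree
  \<open>v\<close>.\<close>

lemma neg_binomial_fps:
  assumes "fps_nth L 0 = (0 :: real)"
  shows "fps_nth (Abs_fps (\<lambda>u. \<Sum>v\<le>u. fps_nth (L ^ v) u) ^ Suc k) u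
     = (\<Sum>v\<le>u. real ((k + v) choose k) * fps_nth (L ^ v) u)"
proof -
  have "Abs_fps (\<lambda>u. \<Sum>v\<le>u. fps_nth (L ^ v) u) = Abs_fps (\<lambda>_. 1) oo L"
    by (rule fps_ext) (simp add: fps_compose_nth atMost_atLeast0)
  then have "Abs_fps (\<lambda>u. \<Sum>v\<le>u. fps_nth (L ^ v) u) ^ Suc k = (Abs_fps (\<lambda>_. 1) ^ Suc k) oo L"
    using fps_compose_power[OF assms] by metis
  then show ?thesis
    unfolding geometric_fps_power by (simp add: fps_compose_nth atMost_atLeast0)
qed

subsection \<open>Splitting walks along an edge\<close>

definition at_end :: "nat \<Rightarrow> nat list \<Rightarrow> bool" where
  "at_end j q \<longleftrightarrow> q \<noteq> [] \<and> hd q = j \<and> last q = j"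

text \<open>For a loop at \<open>i\<close> that avoids \<open>i\<close> inside, this says that the
  edge \<open>{i, j}\<close> is not traversed; \<open>j\<close> may still occur in the interior.
  Empty loops are included, since they do not use the edge either.\<close>

definition off_end :: "nat \<Rightarrow> nat list \<Rightarrow> bool" where
  "off_end j q \<longleftrightarrow> q = [] \<or> hd q \<noteq> j \<and> last q \<noteq> j"

text \<open>These are the walks based at \<open>i\<close> that the edge \<open>{i, j}\<close>
  splits. Only loops using the edge at exactly one end are ruled out, and these contain a cycle. The
  vertex \<open>j\<close> is determined by the walk, being the one visited right after
  \<open>i\<close>.\<close>

definition good :: "nat \<Rightarrow> nat list list \<Rightarrow> bool" where
  "good j ls \<longleftrightarrow> ls \<noteq> [] \<and> at_end j (hd ls) \<and> (\<forall>q\<in>set ls. at_end j q \<or> off_end j q)"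

lemma not_at_off_end: "\<not> (at_end j q \<and> off_end j q)"
  by (auto simp: at_end_def off_end_def)

lemma prod_list_edge_prod_if:
  "(\<Prod>q\<leftarrow>ls. if P q then edge_prod A (loop_edges i q) else 0)
    = (if \<forall>q\<in>set ls. P q then edge_prod A (walk_edges i ls) else 0)"
  by (induction ls) auto

lemma edge_prod_loop_edges_snoc:
  assumes "w = [] \<or> hd w = j" "\<And>x y. A x y = A y x"
  shows "edge_prod A (loop_edges i (w @ [j])) = A i j ^ 2 * edge_prod A (path_edges (w @ [j]))"
proof -
  have "loop_edges i (w @ [j]) = edge i j # path_edges (w @ [j]) @ [edge j i]"
    unfolding loop_edges_def using assms(1) path_edges_snoc[of "w @ [j]" i]
    by (cases w) (auto simp: path_edges_Cons)
  moreover have "A (fst (edge x y)) (snd (edge x y)) = A x y" for x y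
    using assms(2) by (auto simp: edge_def min_def max_def)
  ultimately show ?thesis using assms(2)[of i j] by (simp add: power2_eq_square)
qed

text \<open>Such a loop crosses \<open>{i, j}\<close>, runs through a closed walk at
  \<open>j\<close> that avoids \<open>i\<close>, and crosses back: the two crossings give
  \<open>A i j ^ 2\<close> and \<open>fps_X ^ 2\<close>, and the closed walk, a sequence of any
  number of loops at \<open>j\<close>, gives the geometric series.\<close>

lemma at_end_loop_fps:
  assumes "finite V" "j \<in> V" "i \<noteq> j" "\<And>x y. A x y = A y x"
  shows "loop_fps (V - {i}) (\<lambda>q. if at_end j q then edge_prod A (loop_edges i q) else 0)
    = fps_const (A i j ^ 2) * (fps_X ^ 2 *
        Abs_fps (\<lambda>u. \<Sum>v\<le>u. fps_nth (loop_fps (V - {i, j}) (\<lambda>q. edge_prod A (loop_edges j q)) ^ v) u))"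
    (is "?F = ?G")
proof (rule fps_ext)
  fix n
  consider "n = 0" | "n = Suc 0" | u where "n = Suc (Suc u)" by (metis not0_implies_Suc)
  then show "fps_nth ?F n = fps_nth ?G n"
  proof cases
    case 2
    then show ?thesis
      by (auto simp: loop_fps_def fps_X_power_mult_nth words_def at_end_def)
  next
    case (3 u)
    have ins: "V - {i} = insert j (V - {i, j})" using assms by auto
    have "fps_nth ?F n = (\<Sum>q\<in>{q \<in> words (V - {i}) (Suc u). at_end j q}. edge_prod A (loop_edges i q))"
      using assms(1) by (simp add: 3 loop_fps_def sum.inter_filter)
    also have "\<dots> = (\<Sum>w\<in>{w \<in> words (V - {i}) u. w = [] \<or> hd w = j}. edge_prod A (loop_edges i (w @ [j])))"
    proof (rule sum.reindex_bij_witness[of _ "\<lambda>w. w @ [j]" butlast])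
      fix q assume q: "q \<in> {q \<in> words (V - {i}) (Suc u). at_end j q}"
      then have eq: "butlast q @ [j] = q"
        using append_butlast_last_id[of q] by (simp add: at_end_def)
      then show "butlast q @ [j] = q" "edge_prod A (loop_edges i (butlast q @ [j])) = edge_prod A (loop_edges i q)"
        by simp_all
      obtain w where w: "q = w @ [j]" using eq by metis
      show "butlast q \<in> {w \<in> words (V - {i}) u. w = [] \<or> hd w = j}"
        using q unfolding w by (cases w) (auto simp: at_end_def words_def)
    next
      fix w assume w: "w \<in> {w \<in> words (V - {i}) u. w = [] \<or> hd w = j}"
      then show "w @ [j] \<in> {q \<in> words (V - {i}) (Suc u). at_end j q}"
        using assms by (auto simp: at_end_def words_def hd_append)
    qed auto
    also have "\<dots> = A i j ^ 2 * (\<Sum>w\<in>{w \<in> words (V - {i}) u. w = [] \<or> hd w = j}. edge_prod A (path_edges (w @ [j])))"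
      unfolding sum_distrib_left
      by (intro sum.cong refl edge_prod_loop_edges_snoc) (use assms in auto)
    also have "\<dots> = A i j ^ 2 * (\<Sum>v\<le>u. \<Sum>ls\<in>loops (V - {i, j}) u v. edge_prod A (walk_edges j ls))"
      unfolding ins using assms(1) by (subst sum_closed_words) (auto simp: path_edges_walk)
    also have "\<dots> = fps_nth ?G n"
      using assms(1) prod_list_edge_prod_if[of "\<lambda>_. True" A j]
      by (simp add: 3 fps_X_power_mult_nth loop_fps_power)
    finally show ?thesis .
  qed (simp add: loop_fps_def fps_X_power_mult_nth)
qed

text \<open>Splitting a good walk along the edge \<open>{i, j}\<close>: the loops through \<open>j\<close> are chosen among the
  last \<open>r\<close> ones by the binomial theorem, and the excursions from \<open>j\<close> are distributed over the visits
  to \<open>j\<close> by the expansion of the negative power \<open>(1 - L) ^ -Suc k\<close>.\<close>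

lemma sum_good_walks:
  assumes "finite V" "j \<in> V" "i \<noteq> j" "\<And>x y. A x y = A y x"
  shows "(\<Sum>ls\<in>{ls \<in> loops (V - {i}) n (Suc r). good j ls}. edge_prod A (walk_edges i ls))
    = (\<Sum>k\<le>r. real (r choose k) * (if n < 2 * Suc k then 0 else
        (\<Sum>u\<le>n - 2 * Suc k. \<Sum>v\<le>u. real ((k + v) choose k) *
          (\<Sum>ls1\<in>{ls \<in> loops (V - {i}) (n - 2 * Suc k - u) (r - k). \<forall>q\<in>set ls. off_end j q}.
           \<Sum>ls2\<in>loops (V - {i, j}) u v.
             A i j ^ (2 * Suc k) * (edge_prod A (walk_edges i ls1) * edge_prod A (walk_edges j ls2))))))"
proof -
  define F where "F P = loop_fps (V - {i}) (\<lambda>q. if P q then edge_prod A (loop_edges i q) else 0)" for P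
  define L where "L = loop_fps (V - {i, j}) (\<lambda>q. edge_prod A (loop_edges j q))"
  define G where "G = Abs_fps (\<lambda>u. \<Sum>v\<le>u. fps_nth (L ^ v) u)"
  have Fj: "F (at_end j) = fps_const (A i j ^ 2) * (fps_X ^ 2 * G)"
    unfolding F_def G_def L_def by (rule at_end_loop_fps[OF assms])
  have fin: "finite (V - {i})" "finite (V - {i, j})" using assms by auto
  have "(\<Sum>ls\<in>{ls \<in> loops (V - {i}) n (Suc r). good j ls}. edge_prod A (walk_edges i ls))
     = (\<Sum>ls\<in>loops (V - {i}) n (Suc r). if good j ls then edge_prod A (walk_edges i ls) else 0)"
    using fin by (simp add: sum.inter_filter)
  also have "\<dots> = fps_nth (F (at_end j) * F (\<lambda>q. at_end j q \<or> off_end j q) ^ r) n"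
    unfolding F_def loop_fps_mult_power[OF fin(1)]
  proof (intro sum.cong refl)
    fix ls assume "ls \<in> loops (V - {i}) n (Suc r)"
    then obtain q qs where ls: "ls = q # qs" by (cases ls) (auto simp: loops_def)
    show "(if good j ls then edge_prod A (walk_edges i ls) else 0) =
      (if at_end j (hd ls) then edge_prod A (loop_edges i (hd ls)) else 0) *
      (\<Prod>q\<leftarrow>tl ls. if at_end j q \<or> off_end j q then edge_prod A (loop_edges i q) else 0)"
      unfolding prod_list_edge_prod_if by (auto simp: ls good_def)
  qed
  also have "F (\<lambda>q. at_end j q \<or> off_end j q) = F (at_end j) + F (off_end j)"
    unfolding F_def loop_fps_add[symmetric]
    by (rule arg_cong[where f = "loop_fps (V - {i})"], rule ext) (use not_at_off_end[of j] in auto)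
  \<comment> \<open>The leading loop is forced to go through \<open>j\<close>, and \<open>k\<close>
    of the other \<open>r\<close> loops do so too. Thus \<open>Suc k\<close> is the \<open>f\<close>
    of the recursion for the second index \<open>Suc r\<close>, and \<open>r choose k\<close> is its
    \<open>(r - 1) choose (f - 1)\<close>.\<close>
  also have "F (at_end j) * (F (at_end j) + F (off_end j)) ^ r
     = (\<Sum>k\<le>r. of_nat (r choose k) * (F (at_end j) ^ Suc k * F (off_end j) ^ (r - k)))"
    by (simp add: binomial_ring sum_distrib_left mult_ac)
  also have "fps_nth \<dots> n = (\<Sum>k\<le>r. real (r choose k) * fps_nth (F (at_end j) ^ Suc k * F (off_end j) ^ (r - k)) n)"
    by (simp add: fps_sum_nth fps_of_nat[symmetric] fps_mult_left_const_nth)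
  also have "\<dots> = (\<Sum>k\<le>r. real (r choose k) * (if n < 2 * Suc k then 0 else
        (\<Sum>u\<le>n - 2 * Suc k. \<Sum>v\<le>u. real ((k + v) choose k) *
          (\<Sum>ls1\<in>{ls \<in> loops (V - {i}) (n - 2 * Suc k - u) (r - k). \<forall>q\<in>set ls. off_end j q}.
           \<Sum>ls2\<in>loops (V - {i, j}) u v.
             A i j ^ (2 * Suc k) * (edge_prod A (walk_edges i ls1) * edge_prod A (walk_edges j ls2))))))"
  proof (intro sum.cong refl arg_cong[where f = "(*) (real (r choose _))"])
    fix k
    have "F (at_end j) ^ Suc k = fps_const (A i j ^ (2 * Suc k)) * (fps_X ^ (2 * Suc k) * G ^ Suc k)"
      unfolding Fj by (simp only: power_mult_distrib power_mult fps_const_power)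
    then have "fps_nth (F (at_end j) ^ Suc k * F (off_end j) ^ (r - k)) n
      = fps_nth (fps_const (A i j ^ (2 * Suc k)) * (fps_X ^ (2 * Suc k) * (G ^ Suc k * F (off_end j) ^ (r - k)))) n"
      by (simp only: mult.assoc)
    also have "\<dots> = A i j ^ (2 * Suc k) * (if n < 2 * Suc k then 0
        else fps_nth (G ^ Suc k * F (off_end j) ^ (r - k)) (n - 2 * Suc k))"
      by (simp only: fps_mult_left_const_nth fps_X_power_mult_nth)
    also have "fps_nth (G ^ Suc k * F (off_end j) ^ (r - k)) (n - 2 * Suc k)
       = (\<Sum>u\<le>n - 2 * Suc k. (\<Sum>v\<le>u. real ((k + v) choose k) * fps_nth (L ^ v) u)
           * fps_nth (F (off_end j) ^ (r - k)) (n - 2 * Suc k - u))"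
      unfolding fps_mult_nth G_def
      by (subst neg_binomial_fps) (auto simp: L_def atMost_atLeast0)
    also have "\<dots> = (\<Sum>u\<le>n - 2 * Suc k. \<Sum>v\<le>u. real ((k + v) choose k) *
          (\<Sum>ls1\<in>{ls \<in> loops (V - {i}) (n - 2 * Suc k - u) (r - k). \<forall>q\<in>set ls. off_end j q}.
           \<Sum>ls2\<in>loops (V - {i, j}) u v. edge_prod A (walk_edges i ls1) * edge_prod A (walk_edges j ls2)))"
    proof (intro sum.cong refl)
      fix u
      have 1: "fps_nth (F (off_end j) ^ (r - k)) (n - 2 * Suc k - u) =
        (\<Sum>ls1\<in>{ls \<in> loops (V - {i}) (n - 2 * Suc k - u) (r - k). \<forall>q\<in>set ls. off_end j q}. edge_prod A (walk_edges i ls1))"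
        unfolding F_def loop_fps_power[OF fin(1)] prod_list_edge_prod_if
        using fin by (simp add: sum.inter_filter)
      have 2: "fps_nth (L ^ v) u = (\<Sum>ls2\<in>loops (V - {i, j}) u v. edge_prod A (walk_edges j ls2))" for v
        unfolding L_def loop_fps_power[OF fin(2)] using prod_list_edge_prod_if[of "\<lambda>_. True" A j] by simp
      show "(\<Sum>v\<le>u. real ((k + v) choose k) * fps_nth (L ^ v) u) * fps_nth (F (off_end j) ^ (r - k)) (n - 2 * Suc k - u)
        = (\<Sum>v\<le>u. real ((k + v) choose k) *
          (\<Sum>ls1\<in>{ls \<in> loops (V - {i}) (n - 2 * Suc k - u) (r - k). \<forall>q\<in>set ls. off_end j q}.
           \<Sum>ls2\<in>loops (V - {i, j}) u v. edge_prod A (walk_edges i ls1) * edge_prod A (walk_edges j ls2)))"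
        unfolding 1 2 sum_distrib_right sum_product[symmetric]
        by (intro sum.cong refl) (simp only: mult_ac sum_distrib_left[symmetric] sum_distrib_right[symmetric])
    qed
    finally show "fps_nth (F (at_end j) ^ Suc k * F (off_end j) ^ (r - k)) n
      = (if n < 2 * Suc k then 0 else
        (\<Sum>u\<le>n - 2 * Suc k. \<Sum>v\<le>u. real ((k + v) choose k) *
          (\<Sum>ls1\<in>{ls \<in> loops (V - {i}) (n - 2 * Suc k - u) (r - k). \<forall>q\<in>set ls. off_end j q}.
           \<Sum>ls2\<in>loops (V - {i, j}) u v.
             A i j ^ (2 * Suc k) * (edge_prod A (walk_edges i ls1) * edge_prod A (walk_edges j ls2)))))"
      by (simp only: sum_distrib_left mult.left_commute[of "A i j ^ (2 * Suc k)"] mult_zero_right if_distrib[of "(*) _"] split: if_split)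
  qed
  finally show ?thesis .
qed

subsection \<open>Moments of edge products\<close>

text \<open>A Bernoulli variable equals its positive powers, so a distinct edge carries a single
  \<open>p / N\<close> whatever its multiplicity, while the multiplicity selects the moment of
  \<open>a\<close>. An edge inside one side annihilates the product.\<close>

definition edge_moment :: "real \<Rightarrow> (nat \<Rightarrow> real) \<Rightarrow> nat \<Rightarrow> nat \<Rightarrow> (nat \<times> nat) list \<Rightarrow> real" where
  "edge_moment p X N h es = (\<Prod>e\<in>set es.
     if (fst e < h) \<noteq> (snd e < h) then p / real N * X (count (mset es) e) else 0)"

lemma edge_moment_Nil [simp]: "edge_moment p X N h [] = 1"
  by (simp add: edge_moment_def)

lemma edge_moment_append:
  assumes "set es \<inter> set fs = {}"
  shows "edge_moment p X N h (es @ fs) = edge_moment p X N h es * edge_moment p X N h fs"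
proof -
  have 1: "count (mset fs) e = 0" if "e \<in> set es" for e
    using that assms by (auto simp: count_eq_zero_iff)
  have 2: "count (mset es) e = 0" if "e \<in> set fs" for e
    using that assms by (auto simp: count_eq_zero_iff)
  show ?thesis
    unfolding edge_moment_def set_append using assms
    by (subst prod.union_disjoint) (auto intro!: arg_cong2[where f = "(*)"] prod.cong simp: 1 2)
qed

lemma edge_moment_eq_0:
  assumes "e \<in> set es" "(fst e < h) = (snd e < h)"
  shows "edge_moment p X N h es = 0"
  unfolding edge_moment_def using assms by (auto intro!: prod_zero)

lemma edge_moment_replicate:
  assumes "0 < m"
  shows "edge_moment p X N h (replicate m e) = (if (fst e < h) \<noteq> (snd e < h) then p / real N * X m else 0)"
  unfolding edge_moment_def using assms by (simp add: set_replicate_conv_if)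

text \<open>The summand 1 makes the constant at least 1, so that its powers may be enlarged
  freely.\<close>

definition moment_const :: "real \<Rightarrow> (nat \<Rightarrow> real) \<Rightarrow> nat \<Rightarrow> real" where
  "moment_const p X n = 1 + \<bar>p\<bar> * (\<Sum>c\<le>n. \<bar>X c\<bar>)"

lemma moment_const_ge_1: "1 \<le> moment_const p X n"
  unfolding moment_const_def by (simp add: sum_nonneg)

lemma edge_moment_bound:
  assumes "length es \<le> n"
  shows "\<bar>edge_moment p X N h es\<bar> \<le> moment_const p X n ^ n * (1 / real N) ^ card (set es)"
proof -
  have "\<bar>if (fst e < h) \<noteq> (snd e < h) then p / real N * X (count (mset es) e) else 0\<bar>
      \<le> moment_const p X n * (1 / real N)" for e
  proof -
    have "count (mset es) e \<le> n" using assms count_le_size[of "mset es" e] by simp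
    then have "\<bar>X (count (mset es) e)\<bar> \<le> (\<Sum>c\<le>n. \<bar>X c\<bar>)"
      by (intro member_le_sum) auto
    then have "\<bar>p\<bar> * \<bar>X (count (mset es) e)\<bar> \<le> moment_const p X n"
      unfolding moment_const_def by (smt (verit, best) abs_ge_zero mult_left_mono)
    moreover have "0 \<le> moment_const p X n" using moment_const_ge_1[of p X n] by linarith
    ultimately show ?thesis
      by (auto simp: abs_mult divide_simps)
  qed
  then have "\<bar>edge_moment p X N h es\<bar> \<le> (\<Prod>e\<in>set es. moment_const p X n * (1 / real N))"
    unfolding edge_moment_def abs_prod by (intro prod_mono) auto
  also have "\<dots> = moment_const p X n ^ card (set es) * (1 / real N) ^ card (set es)"
    by (simp add: power_mult_distrib power_divide)
  also have "\<dots> \<le> moment_const p X n ^ n * (1 / real N) ^ card (set es)"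
    using card_length[of es] assms moment_const_ge_1[of p X n]
    by (intro mult_right_mono power_increasing) auto
  finally show ?thesis .
qed

definition bip_matrix :: "(nat \<Rightarrow> nat \<Rightarrow> 'a \<Rightarrow> real) \<Rightarrow> (nat \<Rightarrow> nat \<Rightarrow> nat \<Rightarrow> 'a \<Rightarrow> real)
    \<Rightarrow> nat \<Rightarrow> nat \<Rightarrow> 'a \<Rightarrow> nat \<Rightarrow> nat \<Rightarrow> real" where
  "bip_matrix a d h N x i j = (if (i < h) \<noteq> (j < h) then a i j x * d N i j x else 0)"

lemma edge_prod_eq_0: "e \<in> set es \<Longrightarrow> A (fst e) (snd e) = 0 \<Longrightarrow> edge_prod A es = 0"
  by (induction es) auto

lemma edge_prod_eq_prod: "edge_prod A es = (\<Prod>e\<in>set es. A (fst e) (snd e) ^ count (mset es) e)"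
  unfolding edge_prod_def using image_prod_mset_multiplicity[of "\<lambda>e. A (fst e) (snd e)" "mset es"]
  by (simp flip: prod_mset_prod_list mset_map)

text \<open>Grouping equal edges turns the product into one of powers of distinct independent
  variables, indexed by two disjoint copies of the edge set, one for \<open>a\<close> and one for
  \<open>d\<close>. If some edge stays inside one side, both the product and
  \<open>edge_moment\<close> vanish.\<close>

lemma (in prob_space) edge_prod_expectation:
  fixes a :: "nat \<Rightarrow> nat \<Rightarrow> 'a \<Rightarrow> real" and d :: "nat \<Rightarrow> nat \<Rightarrow> nat \<Rightarrow> 'a \<Rightarrow> real"
  assumes a_ident: "\<And>i j. i \<le> j \<Longrightarrow> distr M borel (a i j) = distr M borel (a 0 0)"
    and a_moments: "\<And>i j k. integrable M (\<lambda>x. a i j x ^ k)"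
    and X_def: "\<And>k. X k = expectation (\<lambda>x. a 0 0 x ^ k)"
    and d_bern: "\<And>i j. i \<le> j \<Longrightarrow> j < N \<Longrightarrow>
                   (\<forall>x\<in>space M. d N i j x \<in> {0, 1}) \<and>
                   measure M {x \<in> space M. d N i j x = 1} = p / real N"
    and indep: "indep_vars (\<lambda>_. borel)
                    (\<lambda>ij. case ij of Inl (i, j) \<Rightarrow> a i j | Inr (i, j) \<Rightarrow> d N i j)
                    ({(i, j). i \<le> j} <+> {(i, j). i \<le> j \<and> j < N})"
    and es: "\<And>e. e \<in> set es \<Longrightarrow> fst e \<le> snd e \<and> snd e < N"
  shows "integrable M (\<lambda>x. edge_prod (bip_matrix a d h N x) es)"
    and "expectation (\<lambda>x. edge_prod (bip_matrix a d h N x) es) = edge_moment p X N h es"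
proof -
  have "integrable M (\<lambda>x. edge_prod (bip_matrix a d h N x) es) \<and>
    expectation (\<lambda>x. edge_prod (bip_matrix a d h N x) es) = edge_moment p X N h es"
  proof (cases "\<exists>e\<in>set es. (fst e < h) = (snd e < h)")
    case True
    then obtain e where e: "e \<in> set es" "(fst e < h) = (snd e < h)" by blast
    then have "edge_prod (bip_matrix a d h N x) es = 0" for x
      by (intro edge_prod_eq_0[OF e(1)]) (simp add: bip_matrix_def)
    then show ?thesis using edge_moment_eq_0[OF e] by simp
  next
    case False
    define S where "S = set es"
    define c where "c = count (mset es)"
    have c: "0 < c e" if "e \<in> S" for e using that by (simp add: c_def S_def)
    have S: "finite S" "\<And>e. e \<in> S \<Longrightarrow> fst e \<le> snd e" "\<And>e. e \<in> S \<Longrightarrow> snd e < N"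
      using es by (auto simp: S_def)
    define Y where "Y = (\<lambda>k x. (case k of Inl (i, j) \<Rightarrow> a i j | Inr (i, j) \<Rightarrow> d N i j) x
        ^ (case k of Inl e \<Rightarrow> c e | Inr e \<Rightarrow> c e) :: real)"
    have indS: "indep_vars (\<lambda>_. borel) (\<lambda>ij. case ij of Inl (i, j) \<Rightarrow> a i j | Inr (i, j) \<Rightarrow> d N i j) (S <+> S)"
      by (rule indep_vars_subset[OF indep]) (use S in \<open>auto simp: split_beta\<close>)
    have indY: "indep_vars (\<lambda>_. borel) Y (S <+> S)"
      unfolding Y_def by (rule indep_vars_compose2[OF indS]) auto
    have meas_a: "random_variable borel (a i j)" if "i \<le> j" for i j
      using indep that unfolding indep_vars_def by (force dest!: bspec[of _ _ "Inl (i, j)"])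
    have meas_d: "random_variable borel (d N i j)" if "i \<le> j" "j < N" for i j
      using indep that unfolding indep_vars_def by (force dest!: bspec[of _ _ "Inr (i, j)"])
    have Ea: "expectation (\<lambda>x. a i j x ^ k) = X k" if "i \<le> j" for i j k
    proof -
      have "expectation (\<lambda>x. a i j x ^ k) = integral\<^sup>L (distr M borel (a i j)) (\<lambda>t. t ^ k)"
        using meas_a[OF that] by (subst integral_distr) auto
      also have "\<dots> = integral\<^sup>L (distr M borel (a 0 0)) (\<lambda>t. t ^ k)"
        using a_ident[OF that] by simp
      also have "\<dots> = X k"
        using meas_a[of 0 0] by (subst integral_distr) (auto simp: X_def)
      finally show ?thesis .
    qed
    have Ed: "integrable M (\<lambda>x. d N i j x ^ k)" "expectation (\<lambda>x. d N i j x ^ k) = p / real N"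
      if "i \<le> j" "j < N" "0 < k" for i j k
    proof -
      let ?B = "{x \<in> space M. d N i j x = 1}"
      have B: "?B \<in> events" using meas_d[OF that(1,2)] by measurable
      \<comment> \<open>Positivity of \<open>k\<close> matters here, as \<open>0 ^ 0 = 1\<close>; it
        holds for the multiplicity of an edge that occurs.\<close>
      have eq: "d N i j x ^ k = indicator ?B x" if "x \<in> space M" for x
        using d_bern[of i j] that \<open>i \<le> j\<close> \<open>j < N\<close> \<open>0 < k\<close> by (auto simp: indicator_def zero_power)
      show "integrable M (\<lambda>x. d N i j x ^ k)"
        using B by (subst Bochner_Integration.integrable_cong[OF refl eq]) (auto simp: emeasure_eq_measure)
      show "expectation (\<lambda>x. d N i j x ^ k) = p / real N"
        using B d_bern[of i j] that by (subst Bochner_Integration.integral_cong[OF refl eq]) auto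
    qed
    have intY: "integrable M (Y k)" if "k \<in> S <+> S" for k
      using that a_moments Ed(1) S c by (fastforce simp: Y_def)
    have prodY: "edge_prod (bip_matrix a d h N x) es = (\<Prod>k\<in>S <+> S. Y k x)" for x
      using False S(1)
      by (auto simp: edge_prod_eq_prod prod.Plus S_def[symmetric] c_def[symmetric] bip_matrix_def Y_def
          split_beta power_mult_distrib prod.distrib[symmetric] intro!: prod.cong)
    have "integrable M (\<lambda>x. \<Prod>k\<in>S <+> S. Y k x)"
      by (rule indep_vars_integrable[OF _ indY intY]) (use S in auto)
    moreover have "expectation (\<lambda>x. \<Prod>k\<in>S <+> S. Y k x) = (\<Prod>k\<in>S <+> S. expectation (Y k))"
      by (rule indep_vars_lebesgue_integral[OF _ indY intY]) (use S in auto)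
    moreover have "(\<Prod>k\<in>S <+> S. expectation (Y k)) = (\<Prod>e\<in>S. expectation (Y (Inl e)) * expectation (Y (Inr e)))"
      using S(1) by (simp add: prod.Plus prod.distrib)
    moreover have "\<dots> = edge_moment p X N h es"
      unfolding edge_moment_def S_def[symmetric] c_def[symmetric]
      using False S c Ea Ed(2) by (intro prod.cong refl) (auto simp: Y_def split_beta S_def)
    ultimately show ?thesis unfolding prodY by simp
  qed
  then show "integrable M (\<lambda>x. edge_prod (bip_matrix a d h N x) es)"
    and "expectation (\<lambda>x. edge_prod (bip_matrix a d h N x) es) = edge_moment p X N h es"
    by auto
qed

lemma sum_words_snoc:
  "(\<Sum>w\<in>words D (Suc n). g w) = (\<Sum>w\<in>words D n. \<Sum>x\<in>D. g (w @ [x]))"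
proof -
  have "(\<Sum>w\<in>words D (Suc n). g w) = (\<Sum>(w, x)\<in>words D n \<times> D. g (w @ [x]))"
    by (rule sum.reindex_bij_witness[of _ "\<lambda>(w, x). w @ [x]" "\<lambda>w. (butlast w, last w)"])
      (auto simp: words_def length_Suc_conv_rev)
  then show ?thesis by (simp add: sum.cartesian_product)
qed

text \<open>The last vertex \<open>j\<close> is kept outside the word, so that
  \<open>hd (w @ [j]) = i\<close> also covers \<open>k = 0\<close>, where it reads
  \<open>j = i\<close>. Symmetry enters because edges forget their direction.\<close>

lemma mat_power_eq_sum_words:
  assumes sym: "\<And>x y. A x y = A y x" and "i < N" "j < N"
  shows "(mat N N (\<lambda>(i, j). A i j) ^\<^sub>m k) $$ (i, j)
    = (\<Sum>w\<in>words {..<N} k. if hd (w @ [j]) = i then edge_prod A (path_edges (w @ [j])) else 0)"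
  using assms(2,3)
proof (induction k arbitrary: i j)
  case 0
  have "words {..<N} 0 = {[]}" by (auto simp: words_def)
  then show ?case using 0 by auto
next
  case (Suc k)
  let ?B = "mat N N (\<lambda>(i, j). A i j)"
  have carrier: "?B ^\<^sub>m k \<in> carrier_mat N N" by (intro pow_carrier_mat) auto
  have "(?B ^\<^sub>m Suc k) $$ (i, j) = (\<Sum>l<N. (?B ^\<^sub>m k) $$ (i, l) * A l j)"
    using Suc.prems carrier by (simp add: scalar_prod_def atLeast0LessThan)
  also have "\<dots> = (\<Sum>l<N. \<Sum>w\<in>words {..<N} k. if hd (w @ [l]) = i then edge_prod A (path_edges (w @ [l])) * A l j else 0)"
    using Suc by (auto simp: sum_distrib_right intro!: sum.cong)
  also have "\<dots> = (\<Sum>w\<in>words {..<N} k. \<Sum>l<N. if hd ((w @ [l]) @ [j]) = i then edge_prod A (path_edges ((w @ [l]) @ [j])) else 0)"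
  proof (subst sum.swap, intro sum.cong refl)
    fix w l
    have "A (fst (edge l j)) (snd (edge l j)) = A l j"
      using sym by (auto simp: edge_def min_def max_def)
    then show "(if hd (w @ [l]) = i then edge_prod A (path_edges (w @ [l])) * A l j else 0)
        = (if hd ((w @ [l]) @ [j]) = i then edge_prod A (path_edges ((w @ [l]) @ [j])) else 0)"
      by (simp add: path_edges_snoc[of "w @ [l]" j] hd_append del: append_assoc)
  qed
  also have "\<dots> = (\<Sum>w\<in>words {..<N} (Suc k). if hd (w @ [j]) = i then edge_prod A (path_edges (w @ [j])) else 0)"
    unfolding sum_words_snoc ..
  finally show ?case .
qed

subsection \<open>Covariance of the moments\<close>

lemma sum_words_append:
  "(\<Sum>w\<in>words D n. \<Sum>w'\<in>words D m. g (w @ w')) = (\<Sum>w\<in>words D (n + m). g w)"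
proof -
  have "(\<Sum>w\<in>words D n. \<Sum>w'\<in>words D m. g (w @ w')) = (\<Sum>(w, w')\<in>words D n \<times> words D m. g (w @ w'))"
    by (simp add: sum.cartesian_product)
  also have "\<dots> = (\<Sum>w\<in>words D (n + m). g w)"
    by (rule sum.reindex_bij_witness[of _ "\<lambda>w. (take n w, drop n w)" "\<lambda>(w, w'). w @ w'"])
      (auto simp: words_def dest: in_set_takeD in_set_dropD)
  finally show ?thesis .
qed

lemma sum_two_words_card_le:
  assumes "0 < N"
  shows "(\<Sum>w\<in>words {..<N} n. \<Sum>w'\<in>words {..<N} m. (1 / real N) ^ card (set w \<union> set w')) \<le> fact (n + m)"
  using sum_words_append[of "\<lambda>w. (1 / real N) ^ card (set w)" "{..<N}" m n] sum_words_card_le[OF assms, of "n + m"]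
  by simp

lemma inverse_power_le:
  assumes "0 < N" "v \<le> Suc c"
  shows "(1 / real N) ^ c \<le> real N * (1 / real N) ^ v"
proof -
  have "(1 / real N) ^ c = real N * (1 / real N) ^ Suc c" using assms by simp
  also have "\<dots> \<le> real N * (1 / real N) ^ v"
    using assms by (intro mult_left_mono power_decreasing) auto
  finally show ?thesis .
qed

text \<open>The joint moment has a factor \<open>1 / N\<close> for every edge of the union, and the
  product of moments has at least as many, since common edges count twice. So the single hypothesis
  on \<open>v\<close>, which expresses connectedness of the union, serves both.\<close>

lemma edge_moment_append_bound:
  assumes N: "0 < N" and len: "length es + length fs \<le> n"
    and v: "v \<le> Suc (card (set es \<union> set fs))"
  shows "\<bar>edge_moment p X N h (es @ fs)\<bar> \<le> (moment_const p X n ^ n)\<^sup>2 * (real N * (1 / real N) ^ v)"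
    and "\<bar>edge_moment p X N h es * edge_moment p X N h fs\<bar> \<le> (moment_const p X n ^ n)\<^sup>2 * (real N * (1 / real N) ^ v)"
proof -
  define K where "K = moment_const p X n ^ n"
  have K: "1 \<le> K" unfolding K_def by (intro one_le_power moment_const_ge_1)
  have "\<bar>edge_moment p X N h (es @ fs)\<bar> \<le> K * (1 / real N) ^ card (set es \<union> set fs)"
    unfolding K_def using len edge_moment_bound[of "es @ fs" n] by simp
  also have "\<dots> \<le> K\<^sup>2 * (real N * (1 / real N) ^ v)"
    using K by (intro mult_mono inverse_power_le[OF N v] self_le_power) auto
  finally show "\<bar>edge_moment p X N h (es @ fs)\<bar> \<le> (moment_const p X n ^ n)\<^sup>2 * (real N * (1 / real N) ^ v)"
    unfolding K_def .
  have "\<bar>edge_moment p X N h es * edge_moment p X N h fs\<bar> \<le> (K * (1 / real N) ^ card (set es)) * (K * (1 / real N) ^ card (set fs))"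
    unfolding abs_mult K_def using len moment_const_ge_1[of p X n]
    by (intro mult_mono edge_moment_bound) (auto intro!: mult_nonneg_nonneg zero_le_power)
  also have "\<dots> = K\<^sup>2 * (1 / real N) ^ (card (set es) + card (set fs))"
    by (simp add: power_add power2_eq_square)
  also have "\<dots> \<le> K\<^sup>2 * (real N * (1 / real N) ^ v)"
    using v card_Un_le[of "set es" "set fs"] by (intro mult_left_mono inverse_power_le[OF N]) auto
  finally show "\<bar>edge_moment p X N h es * edge_moment p X N h fs\<bar> \<le> (moment_const p X n ^ n)\<^sup>2 * (real N * (1 / real N) ^ v)"
    unfolding K_def .
qed

text \<open>Without a common edge the joint moment factorises and the difference is 0. With one, the
  walks meet, their union is connected, and both terms are small.\<close>

lemma edge_moment_covariance_bound:
  assumes N: "0 < N" and len: "length w + length w' \<le> n"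
  shows "\<bar>edge_moment p X N h (path_edges w @ path_edges w') - edge_moment p X N h (path_edges w) * edge_moment p X N h (path_edges w')\<bar>
    \<le> 2 * (moment_const p X n ^ n)\<^sup>2 * (real N * (1 / real N) ^ card (set w \<union> set w'))"
proof (cases "set (path_edges w) \<inter> set (path_edges w') = {}")
  case True
  then show ?thesis by (simp add: edge_moment_append)
next
  case False
  then have "set w \<inter> set w' \<noteq> {}" using ends_path_edges ends_nonempty by fast
  then have v: "card (set w \<union> set w') \<le> Suc (card (set (path_edges w) \<union> set (path_edges w')))"
    by (rule card_two_paths_le)
  have "length (path_edges w) + length (path_edges w') \<le> n"
    using len by (simp add: length_path_edges)
  from edge_moment_append_bound[OF N this v, of p X h] show ?thesis by linarith
qed

lemma path_edges_words:
  assumes "w \<in> words {..<N} n" "e \<in> set (path_edges w)"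
  shows "fst e \<le> snd e \<and> snd e < N"
  using ends_path_edges[OF assms(2)] path_edges_range[OF assms(2)] assms(1)
  by (auto simp: ends_def words_def)

section \<open>The random matrix and the covariance estimate\<close>

locale sparse_bipartite = prob_space M for M :: "'a measure" +
  fixes a :: "nat \<Rightarrow> nat \<Rightarrow> 'a \<Rightarrow> real"
    and d :: "nat \<Rightarrow> nat \<Rightarrow> nat \<Rightarrow> 'a \<Rightarrow> real"
    and p \<alpha> :: real
    and X :: "nat \<Rightarrow> real"
  assumes p_pos: "p > 0"
    and alpha: "0 < \<alpha>" "\<alpha> < 1"
    and a_sym: "\<And>i j. a j i = a i j"
    and a_ident: "\<And>i j. i \<le> j \<Longrightarrow> distr M borel (a i j) = distr M borel (a 0 0)"
    and a_moments: "\<And>i j k. integrable M (\<lambda>x. a i j x ^ k)"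
    and X_def: "\<And>k. X k = expectation (\<lambda>x. a 0 0 x ^ k)"
    and d_sym: "\<And>N i j. d N j i = d N i j"
    and d_bern: "\<And>N i j. real N \<ge> p \<Longrightarrow> i \<le> j \<Longrightarrow> j < N \<Longrightarrow>
                   (\<forall>x\<in>space M. d N i j x \<in> {0, 1}) \<and>
                   measure M {x \<in> space M. d N i j x = 1} = p / real N"
    and indep: "\<And>N. real N \<ge> p \<Longrightarrow>
                  indep_vars (\<lambda>_. borel)
                    (\<lambda>ij. case ij of Inl (i, j) \<Rightarrow> a i j | Inr (i, j) \<Rightarrow> d N i j)
                    ({(i, j). i \<le> j} <+> {(i, j). i \<le> j \<and> j < N})"
begin

definition cut :: "nat \<Rightarrow> nat" where
  "cut N = nat \<lfloor>\<alpha> * real N\<rfloor>"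

abbreviation A :: "nat \<Rightarrow> 'a \<Rightarrow> nat \<Rightarrow> nat \<Rightarrow> real" where
  "A N \<equiv> bip_matrix a d (cut N) N"

abbreviation \<mu> :: "nat \<Rightarrow> (nat \<times> nat) list \<Rightarrow> real" where
  "\<mu> N \<equiv> edge_moment p X N (cut N)"

lemma A_sym: "A N x i j = A N x j i"
  using a_sym d_sym by (auto simp: bip_matrix_def)

lemma N_pos: "p \<le> real N \<Longrightarrow> 0 < N"
  using p_pos by (cases N) auto

lemma eventually_N: "\<forall>\<^sub>F N in sequentially. p \<le> real N"
  by (meson eventually_sequentiallyI nat_ceiling_le_eq)

lemma has_expectation_edge_prod:
  assumes "p \<le> real N" "\<And>e. e \<in> set es \<Longrightarrow> fst e \<le> snd e \<and> snd e < N"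
  shows "has_bochner_integral M (\<lambda>x. edge_prod (A N x) es) (\<mu> N es)"
  using edge_prod_expectation[where a = a and d = d and N = N and X = X and p = p and es = es,
      OF a_ident a_moments X_def d_bern[OF assms(1)] indep[OF assms(1)] assms(2)]
  by (simp add: has_bochner_integral_iff)

lemma norm_moment_eq_trace:
  "norm_moment a d \<alpha> N k x = (\<Sum>i<N. (mat N N (\<lambda>(i, j). A N x i j) ^\<^sub>m k) $$ (i, i)) / real N"
  by (simp add: norm_moment_def A_mat_def bip_matrix_def cut_def)

lemma norm_moment_eq_words:
  "norm_moment a d \<alpha> N k x
    = (\<Sum>w\<in>{w \<in> words {..<N} (Suc k). hd w = last w}. edge_prod (A N x) (path_edges w)) / real N"
proof -
  have "(\<Sum>i<N. (mat N N (\<lambda>(i, j). A N x i j) ^\<^sub>m k) $$ (i, i))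
      = (\<Sum>i<N. \<Sum>w\<in>words {..<N} k. if hd (w @ [i]) = last (w @ [i]) then edge_prod (A N x) (path_edges (w @ [i])) else 0)"
    by (intro sum.cong refl) (subst mat_power_eq_sum_words, auto simp: A_sym)
  also have "\<dots> = (\<Sum>w\<in>words {..<N} (Suc k). if hd w = last w then edge_prod (A N x) (path_edges w) else 0)"
    by (subst sum.swap) (rule sum_words_snoc[symmetric])
  finally show ?thesis by (simp add: norm_moment_eq_trace sum.inter_filter)
qed

lemma covariance_bound:
  assumes N: "p \<le> real N"
  shows "expectation (\<lambda>x. norm_moment a d \<alpha> N k x * norm_moment a d \<alpha> N m x)
      - expectation (norm_moment a d \<alpha> N k) * expectation (norm_moment a d \<alpha> N m)
    \<le> 2 * (moment_const p X (Suc k + Suc m) ^ (Suc k + Suc m))\<^sup>2 * fact (Suc k + Suc m) / real N"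
proof -
  define W where "W k = {w \<in> words {..<N} (Suc k). hd w = last w}" for k
  have W: "W k \<subseteq> words {..<N} (Suc k)" for k by (auto simp: W_def)
  have finW: "finite (W k)" for k using finite_subset[OF W] by auto
  have N0: "0 < N" by (rule N_pos[OF N])
  have E1: "expectation (norm_moment a d \<alpha> N k) = (\<Sum>w\<in>W k. \<mu> N (path_edges w)) / real N" for k
  proof -
    have "has_bochner_integral M (\<lambda>x. (\<Sum>w\<in>W k. edge_prod (A N x) (path_edges w)) / real N)
        ((\<Sum>w\<in>W k. \<mu> N (path_edges w)) / real N)"
      using W[of k] path_edges_words[of _ N "Suc k"]
      by (intro has_bochner_integral_divide_zero has_bochner_integral_sum has_expectation_edge_prod[OF N]) blast+
    then show ?thesis
      unfolding W_def norm_moment_eq_words[abs_def] by (simp add: has_bochner_integral_iff)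
  qed
  have E2: "expectation (\<lambda>x. norm_moment a d \<alpha> N k x * norm_moment a d \<alpha> N m x)
     = (\<Sum>w\<in>W k. \<Sum>w'\<in>W m. \<mu> N (path_edges w @ path_edges w')) / (real N * real N)"
  proof -
    have "has_bochner_integral M (\<lambda>x. (\<Sum>w\<in>W k. \<Sum>w'\<in>W m. edge_prod (A N x) (path_edges w @ path_edges w')) / (real N * real N))
        ((\<Sum>w\<in>W k. \<Sum>w'\<in>W m. \<mu> N (path_edges w @ path_edges w')) / (real N * real N))"
    proof (intro has_bochner_integral_divide_zero has_bochner_integral_sum has_expectation_edge_prod[OF N])
      fix w w' e assume "w \<in> W k" "w' \<in> W m" "e \<in> set (path_edges w @ path_edges w')"
      then show "fst e \<le> snd e \<and> snd e < N"
        using W path_edges_words[of w N "Suc k" e] path_edges_words[of w' N "Suc m" e] by auto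
    qed
    moreover have "norm_moment a d \<alpha> N k x * norm_moment a d \<alpha> N m x
      = (\<Sum>w\<in>W k. \<Sum>w'\<in>W m. edge_prod (A N x) (path_edges w @ path_edges w')) / (real N * real N)" for x
      unfolding norm_moment_eq_words W_def[symmetric] by (simp add: sum_product)
    ultimately show ?thesis by (simp add: has_bochner_integral_iff)
  qed
  let ?K = "2 * (moment_const p X (Suc k + Suc m) ^ (Suc k + Suc m))\<^sup>2"
  have "(\<Sum>w\<in>W k. \<Sum>w'\<in>W m. \<mu> N (path_edges w @ path_edges w'))
      - (\<Sum>w\<in>W k. \<mu> N (path_edges w)) * (\<Sum>w\<in>W m. \<mu> N (path_edges w))
    = (\<Sum>w\<in>W k. \<Sum>w'\<in>W m. \<mu> N (path_edges w @ path_edges w') - \<mu> N (path_edges w) * \<mu> N (path_edges w'))"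
    by (simp add: sum_product sum_subtractf)
  also have "\<dots> \<le> (\<Sum>w\<in>W k. \<Sum>w'\<in>W m. ?K * (real N * (1 / real N) ^ card (set w \<union> set w')))"
  proof (intro sum_mono)
    fix w w' assume "w \<in> W k" "w' \<in> W m"
    then have "length w + length w' \<le> Suc k + Suc m" by (auto simp: W_def words_def)
    from edge_moment_covariance_bound[OF N0 this, of p X "cut N"]
    show "\<mu> N (path_edges w @ path_edges w') - \<mu> N (path_edges w) * \<mu> N (path_edges w')
      \<le> ?K * (real N * (1 / real N) ^ card (set w \<union> set w'))" by linarith
  qed
  also have "\<dots> \<le> (\<Sum>w\<in>words {..<N} (Suc k). \<Sum>w'\<in>words {..<N} (Suc m). ?K * (real N * (1 / real N) ^ card (set w \<union> set w')))"
    using W by (intro order_trans[OF sum_mono sum_mono2] sum_mono2 sum_nonneg) auto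
  also have "\<dots> = ?K * real N * (\<Sum>w\<in>words {..<N} (Suc k). \<Sum>w'\<in>words {..<N} (Suc m). (1 / real N) ^ card (set w \<union> set w'))"
    by (simp only: sum_distrib_left mult.assoc)
  also have "\<dots> \<le> ?K * real N * fact (Suc k + Suc m)"
    by (intro mult_left_mono sum_two_words_card_le N0) auto
  finally have "((\<Sum>w\<in>W k. \<Sum>w'\<in>W m. \<mu> N (path_edges w @ path_edges w'))
      - (\<Sum>w\<in>W k. \<mu> N (path_edges w)) * (\<Sum>w\<in>W m. \<mu> N (path_edges w))) / (real N * real N)
    \<le> ?K * real N * fact (Suc k + Suc m) / (real N * real N)"
    by (intro divide_right_mono) auto
  also have "\<dots> = ?K * fact (Suc k + Suc m) / real N" using N0 by simp
  finally show ?thesis unfolding E1 E2 by (simp add: diff_divide_distrib)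
qed

end

subsection \<open>Error terms\<close>

lemma length_walk_edges: "ls \<in> loops D n r \<Longrightarrow> length (walk_edges i ls) = n"
  using length_walk[of ls D n r i] by (simp flip: path_edges_walk add: length_path_edges)

lemma set_walk_snoc: "set (walk i ls @ [i]) = insert i (\<Union> (set ` set ls))"
  by (auto simp: set_walk split: if_splits)

lemma set_loop_edges_subset: "q \<in> set ls \<Longrightarrow> set (loop_edges i q) \<subseteq> set (walk_edges i ls)"
  by (auto simp: walk_edges_def)

text \<open>The base point is the last letter of \<open>walk i ls @ [i]\<close>, and the loops are
  recovered from the rest, so distinct pairs of base point and loops give distinct words.\<close>

lemma sum_walks_le_sum_words:
  assumes "finite V" "\<And>w. 0 \<le> (g w :: real)"
  shows "(\<Sum>i\<in>V. \<Sum>ls\<in>loops (V - {i}) n r. g (walk i ls @ [i])) \<le> (\<Sum>w\<in>words V (Suc n). g w)"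
proof -
  have "(\<Sum>ls\<in>loops (V - {i}) n r. g (walk i ls @ [i])) \<le> (\<Sum>w\<in>words V n. g (w @ [i]))" if i: "i \<in> V" for i
  proof (cases "r \<le> n")
    case True
    have "(\<Sum>ls\<in>loops (V - {i}) n r. g (walk i ls @ [i])) \<le> (\<Sum>r\<le>n. \<Sum>ls\<in>loops (V - {i}) n r. g (walk i ls @ [i]))"
      using True assms by (intro member_le_sum[of r "{..n}"] sum_nonneg) auto
    also have "\<dots> = (\<Sum>w\<in>{w \<in> words (insert i (V - {i})) n. w = [] \<or> hd w = i}. g (w @ [i]))"
      using assms by (subst sum_closed_words) auto
    also have "\<dots> \<le> (\<Sum>w\<in>words V n. g (w @ [i]))"
      using assms i by (intro sum_mono2) (auto simp: insert_absorb)
    finally show ?thesis .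
  next
    case False
    then have "loops (V - {i}) n r = {}" using loops_length_le by blast
    then show ?thesis using assms by (simp add: sum_nonneg)
  qed
  then have "(\<Sum>i\<in>V. \<Sum>ls\<in>loops (V - {i}) n r. g (walk i ls @ [i])) \<le> (\<Sum>i\<in>V. \<Sum>w\<in>words V n. g (w @ [i]))"
    by (rule sum_mono)
  also have "\<dots> = (\<Sum>w\<in>words V (Suc n). g w)"
    by (subst sum.swap) (rule sum_words_snoc[symmetric])
  finally show ?thesis .
qed

lemma sum_walk_pairs_card_le:
  assumes "0 < N"
  shows "(\<Sum>i<N. \<Sum>j<N. \<Sum>ls1\<in>loops ({..<N} - {i}) n r. \<Sum>ls2\<in>loops ({..<N} - {j}) m v.
      (1 / real N) ^ card (set (walk i ls1 @ [i]) \<union> set (walk j ls2 @ [j]))) \<le> fact (Suc n + Suc m)"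
proof -
  define g where "g w = (\<Sum>j<N. \<Sum>ls2\<in>loops ({..<N} - {j}) m v. (1 / real N) ^ card (set w \<union> set (walk j ls2 @ [j])))" for w
  have g: "g w \<le> (\<Sum>w'\<in>words {..<N} (Suc m). (1 / real N) ^ card (set w \<union> set w'))" for w
    unfolding g_def by (rule sum_walks_le_sum_words) auto
  have "(\<Sum>i<N. \<Sum>j<N. \<Sum>ls1\<in>loops ({..<N} - {i}) n r. \<Sum>ls2\<in>loops ({..<N} - {j}) m v.
      (1 / real N) ^ card (set (walk i ls1 @ [i]) \<union> set (walk j ls2 @ [j])))
    = (\<Sum>i<N. \<Sum>ls1\<in>loops ({..<N} - {i}) n r. g (walk i ls1 @ [i]))"
    unfolding g_def by (subst sum.swap) (rule refl)
  also have "\<dots> \<le> (\<Sum>w\<in>words {..<N} (Suc n). g w)"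
    by (rule sum_walks_le_sum_words) (auto simp: g_def sum_nonneg)
  also have "\<dots> \<le> (\<Sum>w\<in>words {..<N} (Suc n). \<Sum>w'\<in>words {..<N} (Suc m). (1 / real N) ^ card (set w \<union> set w'))"
    by (intro sum_mono g)
  also have "\<dots> \<le> fact (Suc n + Suc m)"
    by (rule sum_two_words_card_le[OF assms])
  finally show ?thesis .
qed

text \<open>An empty loop is an edge inside one side, so the moment vanishes. Otherwise let
  \<open>j\<close> be the vertex visited right after \<open>i\<close>: if every loop had equal ends,
  the walk would be good for this \<open>j\<close>. So some loop has different ends, which forces at
  least as many edges as vertices.\<close>

lemma edge_moment_not_good_bound:
  assumes ls: "ls \<in> loops (V - {i}) n (Suc r)" and bad: "\<And>j. j \<in> V - {i} \<Longrightarrow> \<not> good j ls"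
  shows "\<bar>edge_moment p X N h (walk_edges i ls)\<bar>
    \<le> moment_const p X n ^ n * (1 / real N) ^ card (set (walk i ls @ [i]))"
proof (cases "[] \<in> set ls")
  case True
  have "edge i i \<in> set (loop_edges i [])" by (simp add: loop_edges_def)
  then have "edge i i \<in> set (walk_edges i ls)"
    using set_loop_edges_subset[OF True, of i] by blast
  then have "edge_moment p X N h (walk_edges i ls) = 0"
    by (rule edge_moment_eq_0) (simp add: edge_def)
  then show ?thesis using moment_const_ge_1[of p X n] by simp
next
  case False
  then obtain q0 qs where q0: "ls = q0 # qs" "q0 \<noteq> []"
    using ls by (cases ls) (auto simp: loops_def)
  define j where "j = hd q0"
  have "set q0 \<subseteq> V - {i}" using ls q0 by (auto simp: loops_def)
  then have "j \<in> V - {i}" unfolding j_def using hd_in_set[OF q0(2)] by blast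
  then have "\<not> good j ls" by (rule bad)
  then obtain q where q: "q \<in> set ls" "q \<noteq> []" "hd q \<noteq> last q"
    using False q0 unfolding good_def at_end_def off_end_def j_def
    by (metis list.sel(1) list.set_intros(1) list.distinct(1))
  let ?w = "walk i ls @ [i]"
  have "hd ?w = i" using walk_snoc_cases[of i ls] by (metis list.sel(1))
  moreover have "set (path_edges (i # q @ [i])) \<subseteq> set (path_edges ?w)"
    using set_loop_edges_subset[OF q(1), of i] by (simp add: path_edges_walk loop_edges_def)
  moreover have "set (i # q) \<subseteq> set ?w" using q by (auto simp: set_walk)
  moreover have "i \<notin> set q" using ls q by (auto simp: loops_def)
  ultimately have "card (set ?w) \<le> card (set (path_edges ?w))"
    using q by (intro card_walk_with_open_loop_le[of ?w i q]) auto
  then have le: "card (set ?w) \<le> card (set (walk_edges i ls))" by (simp only: path_edges_walk)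
  have "\<bar>edge_moment p X N h (walk_edges i ls)\<bar> \<le> moment_const p X n ^ n * (1 / real N) ^ card (set (walk_edges i ls))"
    using length_walk_edges[OF ls, of i] by (intro edge_moment_bound) auto
  also have "\<dots> \<le> moment_const p X n ^ n * (1 / real N) ^ card (set ?w)"
    using moment_const_ge_1[of p X n] le
    by (cases "N = 0") (auto intro!: mult_left_mono power_decreasing simp: power_0_left card_gt_0_iff)
  finally show ?thesis .
qed

text \<open>As \<open>i\<close> is not in the interior of a loop, the edge could only be its first
  or last step, which \<open>off_end\<close> forbids.\<close>

lemma edge_notin_walk_edges_off_end:
  assumes "\<forall>q\<in>set ls. off_end j q \<and> i \<notin> set q" "i \<noteq> j"
  shows "edge i j \<notin> set (walk_edges i ls)"
proof
  assume "edge i j \<in> set (walk_edges i ls)"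
  then obtain q where q: "q \<in> set ls" "edge i j \<in> set (loop_edges i q)"
    by (auto simp: walk_edges_def)
  show False
  proof (cases "q = []")
    case True
    then show ?thesis using q assms by (auto simp: loop_edges_def edge_eq_iff)
  next
    case False
    have "edge i j \<notin> set (path_edges q)"
      using ends_path_edges[of "edge i j" q] assms q by auto
    then have "edge i j = edge i (hd q) \<or> edge i j = edge (last q) i"
      using q False by (auto simp: loop_edges_def path_edges_Cons path_edges_snoc)
    then show ?thesis using assms q False by (auto simp: edge_eq_iff off_end_def)
  qed
qed

lemma ends_walk_edges: "e \<in> set (walk_edges i ls) \<Longrightarrow> ends e \<subseteq> set (walk i ls @ [i])"
  using ends_path_edges[of e "walk i ls @ [i]"] by (simp only: path_edges_walk)

text \<open>The two walks obtained by deleting the edge \<open>{i, j}\<close> become independent as soon as they are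
  vertex disjoint; all other pairs have a connected union and are therefore negligible.\<close>

lemma edge_moment_split_bound:
  fixes p :: real and X :: "nat \<Rightarrow> real" and h :: nat
  assumes N: "0 < N" and ls1: "ls1 \<in> loops (V - {i}) n r" and ls2: "ls2 \<in> loops (V - {j}) m v" and k: "0 < k"
  defines "\<mu> \<equiv> edge_moment p X N h"
  shows "\<bar>(if i \<noteq> j \<and> (\<forall>q\<in>set ls1. off_end j q) \<and> (\<forall>q\<in>set ls2. i \<notin> set q)
        then \<mu> (replicate k (edge i j) @ walk_edges i ls1 @ walk_edges j ls2) else 0)
      - \<mu> (replicate k (edge i j)) * (\<mu> (walk_edges i ls1) * \<mu> (walk_edges j ls2))\<bar>
    \<le> 2 * \<bar>p * X k\<bar> * (moment_const p X (n + m) ^ (n + m))\<^sup>2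
      * (1 / real N) ^ card (set (walk i ls1 @ [i]) \<union> set (walk j ls2 @ [j]))"
proof -
  let ?w1 = "walk i ls1 @ [i]" and ?w2 = "walk j ls2 @ [j]"
  let ?E1 = "walk_edges i ls1" and ?E2 = "walk_edges j ls2" and ?R = "replicate k (edge i j)"
  let ?sep = "i \<noteq> j \<and> (\<forall>q\<in>set ls1. off_end j q) \<and> (\<forall>q\<in>set ls2. i \<notin> set q)"
  let ?K = "(moment_const p X (n + m) ^ (n + m))\<^sup>2" and ?c = "card (set ?w1 \<union> set ?w2)"
  have avoid: "\<forall>q\<in>set ls1. i \<notin> set q" using ls1 by (auto simp: loops_def)
  have setR: "set ?R = {edge i j}" using k by simp
  have split: "\<mu> (?R @ ?E1 @ ?E2) = \<mu> ?R * \<mu> (?E1 @ ?E2)" if ?sep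
  proof -
    have "edge i j \<notin> set ?E1" using that avoid by (intro edge_notin_walk_edges_off_end) auto
    moreover have "edge i j \<notin> set ?E2"
      using that ends_walk_edges[of "edge i j" j ls2] unfolding set_walk_snoc by auto
    ultimately show ?thesis unfolding \<mu>_def using setR by (intro edge_moment_append) auto
  qed
  show ?thesis
  proof (cases "set ?w1 \<inter> set ?w2 = {}")
    case True
    have j: "j \<notin> set q" if "q \<in> set ls1" for q using that True unfolding set_walk_snoc by auto
    have "off_end j q" if "q \<in> set ls1" for q
      using j[OF that] hd_in_set[of q] last_in_set[of q] by (auto simp: off_end_def)
    then have sep: ?sep using True unfolding set_walk_snoc by auto
    have "set ?E1 \<inter> set ?E2 = {}"
      using True ends_walk_edges[of _ i ls1] ends_walk_edges[of _ j ls2] ends_nonempty by blast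
    then have "\<mu> (?E1 @ ?E2) = \<mu> ?E1 * \<mu> ?E2" unfolding \<mu>_def by (rule edge_moment_append)
    then show ?thesis using sep split[OF sep] by simp
  next
    case False
    have c: "?c \<le> Suc (card (set ?E1 \<union> set ?E2))"
      using card_two_paths_le[OF False] by (simp only: path_edges_walk)
    have len: "length ?E1 + length ?E2 \<le> n + m"
      using length_walk_edges[OF ls1, of i] length_walk_edges[OF ls2, of j] by simp
    have R: "\<bar>\<mu> ?R\<bar> \<le> \<bar>p * X k\<bar> * (1 / real N)"
      unfolding \<mu>_def edge_moment_replicate[OF k] by (auto simp: abs_mult)
    \<comment> \<open>A connected union costs a factor \<open>N\<close>, which the
      \<open>1 / N\<close> of the deleted edge cancels.\<close>
    have prod_le: "\<bar>\<mu> ?R * y\<bar> \<le> \<bar>p * X k\<bar> * ?K * (1 / real N) ^ ?c"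
      if "\<bar>y\<bar> \<le> ?K * (real N * (1 / real N) ^ ?c)" for y
    proof -
      have "\<bar>\<mu> ?R * y\<bar> \<le> (\<bar>p * X k\<bar> * (1 / real N)) * (?K * (real N * (1 / real N) ^ ?c))"
        unfolding abs_mult[of "\<mu> ?R"] by (intro mult_mono R that) auto
      also have "\<dots> = \<bar>p * X k\<bar> * ?K * (1 / real N) ^ ?c" using N by simp
      finally show ?thesis .
    qed
    have "\<bar>\<mu> ?R * \<mu> (?E1 @ ?E2)\<bar> \<le> \<bar>p * X k\<bar> * ?K * (1 / real N) ^ ?c"
      unfolding \<mu>_def by (intro prod_le[unfolded \<mu>_def] edge_moment_append_bound[OF N len c])
    moreover have "\<bar>\<mu> ?R * (\<mu> ?E1 * \<mu> ?E2)\<bar> \<le> \<bar>p * X k\<bar> * ?K * (1 / real N) ^ ?c"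
      unfolding \<mu>_def by (intro prod_le[unfolded \<mu>_def] edge_moment_append_bound[OF N len c])
    moreover have "\<bar>(if ?sep then y else 0) - z\<bar> \<le> 2 * B" if "\<bar>y\<bar> \<le> B" "\<bar>z\<bar> \<le> B" for y z B :: real
      using that by auto
    ultimately have "\<bar>(if ?sep then \<mu> ?R * \<mu> (?E1 @ ?E2) else 0) - \<mu> ?R * (\<mu> ?E1 * \<mu> ?E2)\<bar>
        \<le> 2 * (\<bar>p * X k\<bar> * ?K * (1 / real N) ^ ?c)" by blast
    moreover have "(if ?sep then \<mu> (?R @ ?E1 @ ?E2) else 0) = (if ?sep then \<mu> ?R * \<mu> (?E1 @ ?E2) else 0)"
      by (rule if_cong[OF refl split refl])
    ultimately show ?thesis by (simp only: mult.assoc)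
  qed
qed

context sparse_bipartite
begin

definition side :: "nat \<Rightarrow> bool \<Rightarrow> nat set" where
  "side N b = {i. i < N \<and> (i < cut N) = b}"

text \<open>The finite \<open>N\<close> analogue of the numbers \<open>S\<close>, indexed by the full length \<open>n = 2 l\<close>.\<close>

definition \<sigma> :: "nat \<Rightarrow> bool \<Rightarrow> nat \<Rightarrow> nat \<Rightarrow> real" where
  "\<sigma> N b n r = (\<Sum>i\<in>side N b. \<Sum>ls\<in>loops ({..<N} - {i}) n r. \<mu> N (walk_edges i ls)) / real N"

lemma finite_side [simp]: "finite (side N b)"
  by (simp add: side_def)

lemma side_subset: "side N b \<subseteq> {..<N}"
  by (auto simp: side_def)

lemma walk_edges_range:
  assumes "ls \<in> loops ({..<N} - D) n r" "i < N" "e \<in> set (walk_edges i ls)"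
  shows "fst e \<le> snd e \<and> snd e < N"
proof -
  have e: "e \<in> set (path_edges (walk i ls @ [i]))" using assms by (simp only: path_edges_walk)
  then have "ends e \<subseteq> set (walk i ls @ [i])" by (rule ends_path_edges)
  also have "\<dots> \<subseteq> {..<N}" using assms(1,2) unfolding set_walk_snoc by (auto simp: loops_def)
  finally show ?thesis using path_edges_range[OF e] by (auto simp: ends_def)
qed

lemma expectation_norm_moment:
  assumes N: "p \<le> real N"
  shows "expectation (norm_moment a d \<alpha> N n) = (\<Sum>r\<le>n. \<sigma> N True n r + \<sigma> N False n r)"
proof -
  let ?L = "\<lambda>i r. loops ({..<N} - {i}) n r"
  have eq: "norm_moment a d \<alpha> N n x = (\<Sum>i<N. \<Sum>r\<le>n. \<Sum>ls\<in>?L i r. edge_prod (A N x) (walk_edges i ls)) / real N" for x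
  proof -
    have "(mat N N (\<lambda>(i, j). A N x i j) ^\<^sub>m n) $$ (i, i)
      = (\<Sum>r\<le>n. \<Sum>ls\<in>?L i r. edge_prod (A N x) (walk_edges i ls))" if i: "i < N" for i
    proof -
      have "(mat N N (\<lambda>(i, j). A N x i j) ^\<^sub>m n) $$ (i, i)
        = (\<Sum>w\<in>{w \<in> words {..<N} n. w = [] \<or> hd w = i}. edge_prod (A N x) (path_edges (w @ [i])))"
        using i A_sym by (subst mat_power_eq_sum_words)
          (auto simp: sum.inter_filter hd_append intro!: sum.cong)
      also have "{..<N} = insert i ({..<N} - {i})" using i by auto
      finally show ?thesis by (subst (asm) sum_closed_words) (auto simp: path_edges_walk)
    qed
    then show ?thesis by (simp add: norm_moment_eq_trace)
  qed
  have "has_bochner_integral M (norm_moment a d \<alpha> N n)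
      ((\<Sum>i<N. \<Sum>r\<le>n. \<Sum>ls\<in>?L i r. \<mu> N (walk_edges i ls)) / real N)"
    unfolding eq[abs_def] using walk_edges_range
    by (intro has_bochner_integral_divide_zero has_bochner_integral_sum has_expectation_edge_prod[OF N]) blast
  then have "expectation (norm_moment a d \<alpha> N n)
      = (\<Sum>i<N. \<Sum>r\<le>n. \<Sum>ls\<in>?L i r. \<mu> N (walk_edges i ls)) / real N"
    by (simp add: has_bochner_integral_iff)
  moreover have "{..<N} = side N True \<union> side N False" by (auto simp: side_def)
  moreover have "(\<Sum>i\<in>side N True \<union> side N False. \<Sum>r\<le>n. \<Sum>ls\<in>?L i r. \<mu> N (walk_edges i ls))
    = (\<Sum>i\<in>side N True. \<Sum>r\<le>n. \<Sum>ls\<in>?L i r. \<mu> N (walk_edges i ls))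
      + (\<Sum>i\<in>side N False. \<Sum>r\<le>n. \<Sum>ls\<in>?L i r. \<mu> N (walk_edges i ls))"
    by (intro sum.union_disjoint) (auto simp: side_def)
  moreover have "(\<Sum>i\<in>side N b. \<Sum>r\<le>n. \<Sum>ls\<in>?L i r. \<mu> N (walk_edges i ls)) / real N = (\<Sum>r\<le>n. \<sigma> N b n r)" for b
    unfolding \<sigma>_def by (subst sum.swap) (simp only: sum_divide_distrib)
  ultimately show ?thesis by (simp only: add_divide_distrib sum.distrib)
qed

text \<open>Both sides are expectations of the same random variable, written in the two ways given
  by \<open>sum_good_walks\<close> at each sample point. On the right the power of
  \<open>A i j\<close> is read as a repeated edge, so that it is merged with further occurrences of
  \<open>{i, j}\<close> in the two pieces.\<close>

lemma good_walks_moment: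
  assumes N: "p \<le> real N" and ij: "i < N" "j < N" "i \<noteq> j"
  shows "(\<Sum>ls\<in>{ls \<in> loops ({..<N} - {i}) n (Suc r). good j ls}. \<mu> N (walk_edges i ls))
    = (\<Sum>k\<le>r. real (r choose k) * (if n < 2 * Suc k then 0 else
        (\<Sum>u\<le>n - 2 * Suc k. \<Sum>v\<le>u. real ((k + v) choose k) *
          (\<Sum>ls1\<in>{ls \<in> loops ({..<N} - {i}) (n - 2 * Suc k - u) (r - k). \<forall>q\<in>set ls. off_end j q}.
           \<Sum>ls2\<in>loops ({..<N} - {i, j}) u v.
             \<mu> N (replicate (2 * Suc k) (edge i j) @ walk_edges i ls1 @ walk_edges j ls2)))))"
    (is "?L = ?R")
proof -
  have "has_bochner_integral M (\<lambda>x. \<Sum>ls\<in>{ls \<in> loops ({..<N} - {i}) n (Suc r). good j ls}. edge_prod (A N x) (walk_edges i ls)) ?L"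
    using walk_edges_range ij by (intro has_bochner_integral_sum has_expectation_edge_prod[OF N]) blast
  moreover have "has_bochner_integral M (\<lambda>x. \<Sum>ls\<in>{ls \<in> loops ({..<N} - {i}) n (Suc r). good j ls}. edge_prod (A N x) (walk_edges i ls)) ?R"
  proof -
    have base: "has_bochner_integral M
        (\<lambda>x. A N x i j ^ (2 * Suc k) * (edge_prod (A N x) (walk_edges i ls1) * edge_prod (A N x) (walk_edges j ls2)))
        (\<mu> N (replicate (2 * Suc k) (edge i j) @ walk_edges i ls1 @ walk_edges j ls2))"
      if "ls1 \<in> loops ({..<N} - {i}) n1 r1" "ls2 \<in> loops ({..<N} - {i, j}) u v" for k ls1 ls2 n1 r1 u v
    proof -
      have "edge_prod (A N x) (replicate m (edge i j)) = A N x i j ^ m" for x m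
      proof -
        have "A N x (fst (edge i j)) (snd (edge i j)) = A N x i j"
          using A_sym by (auto simp: edge_def min_def max_def)
        then show ?thesis by (induction m) auto
      qed
      then have "A N x i j ^ (2 * Suc k) * (edge_prod (A N x) (walk_edges i ls1) * edge_prod (A N x) (walk_edges j ls2))
        = edge_prod (A N x) (replicate (2 * Suc k) (edge i j) @ walk_edges i ls1 @ walk_edges j ls2)" for x
        by (simp only: edge_prod_simps)
      moreover have "fst e \<le> snd e \<and> snd e < N"
        if "e \<in> set (replicate (2 * Suc k) (edge i j) @ walk_edges i ls1 @ walk_edges j ls2)" for e
      proof -
        have "e = edge i j \<or> e \<in> set (walk_edges i ls1) \<or> e \<in> set (walk_edges j ls2)"
          using that by auto
        then show ?thesis
          using walk_edges_range[OF \<open>ls1 \<in> _\<close> ij(1)] walk_edges_range[OF \<open>ls2 \<in> _\<close> ij(2)] ij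
          by (elim disjE) (simp add: edge_def, blast+)
      qed
      ultimately show ?thesis by (simp only:) (rule has_expectation_edge_prod[OF N])
    qed
    show ?thesis
      unfolding sum_good_walks[OF finite_lessThan, of j N i, OF _ ij(3) A_sym, simplified ij lessThan_iff, OF TrueI]
    proof (intro has_bochner_integral_sum has_bochner_integral_mult_right)
      fix k
      let ?f = "\<lambda>x. \<Sum>u\<le>n - 2 * Suc k. \<Sum>v\<le>u. real ((k + v) choose k) *
          (\<Sum>ls1\<in>{ls \<in> loops ({..<N} - {i}) (n - 2 * Suc k - u) (r - k). \<forall>q\<in>set ls. off_end j q}.
           \<Sum>ls2\<in>loops ({..<N} - {i, j}) u v.
             A N x i j ^ (2 * Suc k) * (edge_prod (A N x) (walk_edges i ls1) * edge_prod (A N x) (walk_edges j ls2)))"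
      let ?s = "\<Sum>u\<le>n - 2 * Suc k. \<Sum>v\<le>u. real ((k + v) choose k) *
          (\<Sum>ls1\<in>{ls \<in> loops ({..<N} - {i}) (n - 2 * Suc k - u) (r - k). \<forall>q\<in>set ls. off_end j q}.
           \<Sum>ls2\<in>loops ({..<N} - {i, j}) u v.
             \<mu> N (replicate (2 * Suc k) (edge i j) @ walk_edges i ls1 @ walk_edges j ls2))"
      have "has_bochner_integral M ?f ?s"
        by (intro has_bochner_integral_sum has_bochner_integral_mult_right base) auto
      then show "has_bochner_integral M (\<lambda>x. if n < 2 * Suc k then 0 else ?f x) (if n < 2 * Suc k then 0 else ?s)"
        by (cases "n < 2 * Suc k") (simp_all only: if_True if_False has_bochner_integral_zero)
    qed
  qed
  ultimately show ?thesis by (rule has_bochner_integral_eq)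
qed

end

subsection \<open>Asymptotic recursion and limits\<close>

lemma abs_mult_if_le:
  "\<bar>y\<bar> \<le> z \<Longrightarrow> 0 \<le> c \<Longrightarrow> \<bar>c * (if P then 0 else y)\<bar> \<le> c * (if P then 0 else z :: real)"
  by (auto simp: abs_mult mult_left_mono)

lemma sum_pull_out:
  fixes c :: "nat \<Rightarrow> real"
  shows "(\<Sum>z\<in>Z. \<Sum>k\<le>r. c k * (if P k then 0 else \<Sum>u\<le>m k. \<Sum>v\<le>u. e k v * T z k u v))
    = (\<Sum>k\<le>r. c k * (if P k then 0 else \<Sum>u\<le>m k. \<Sum>v\<le>u. e k v * (\<Sum>z\<in>Z. T z k u v)))"
proof (subst sum.swap, intro sum.cong refl)
  fix k
  have "(\<Sum>z\<in>Z. \<Sum>u\<le>m k. \<Sum>v\<le>u. e k v * T z k u v) = (\<Sum>u\<le>m k. \<Sum>v\<le>u. e k v * (\<Sum>z\<in>Z. T z k u v))"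
    by (subst sum.swap, intro sum.cong refl, subst sum.swap) (simp only: sum_distrib_left)
  then show "(\<Sum>z\<in>Z. c k * (if P k then 0 else \<Sum>u\<le>m k. \<Sum>v\<le>u. e k v * T z k u v))
    = c k * (if P k then 0 else \<Sum>u\<le>m k. \<Sum>v\<le>u. e k v * (\<Sum>z\<in>Z. T z k u v))"
    by (cases "P k") (simp_all add: sum_distrib_left[symmetric])
qed

lemma sum_diff_combine:
  fixes c :: "nat \<Rightarrow> real"
  shows "(\<Sum>k\<le>r. c k * (if P k then 0 else \<Sum>u\<le>m k. \<Sum>v\<le>u. e k v * x k u v))
      - y * (\<Sum>k\<le>r. c k * (if P k then 0 else \<Sum>u\<le>m k. \<Sum>v\<le>u. e k v * z k u v))
    = (\<Sum>k\<le>r. c k * (if P k then 0 else \<Sum>u\<le>m k. \<Sum>v\<le>u. e k v * (x k u v - y * z k u v)))"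
  unfolding sum_distrib_left[of y "\<lambda>k. c k * _ k"] sum_subtractf[symmetric]
proof (rule sum.cong[OF refl])
  fix k
  have "(\<Sum>u\<le>m k. \<Sum>v\<le>u. e k v * x k u v) - y * (\<Sum>u\<le>m k. \<Sum>v\<le>u. e k v * z k u v)
      = (\<Sum>u\<le>m k. \<Sum>v\<le>u. e k v * (x k u v - y * z k u v))"
    by (simp add: sum_distrib_left sum_subtractf right_diff_distrib mult.left_commute)
  then show "c k * (if P k then 0 else \<Sum>u\<le>m k. \<Sum>v\<le>u. e k v * x k u v)
      - y * (c k * (if P k then 0 else \<Sum>u\<le>m k. \<Sum>v\<le>u. e k v * z k u v))
    = c k * (if P k then 0 else \<Sum>u\<le>m k. \<Sum>v\<le>u. e k v * (x k u v - y * z k u v))"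
    by (cases "P k") (simp_all flip: right_diff_distrib add: mult.left_commute[of y])
qed

context sparse_bipartite
begin

text \<open>The sets of good walks for different \<open>j\<close> are disjoint, as the leading loop
  determines \<open>j\<close>. The difference is thus a sum over walks that are good for no
  \<open>j\<close>; these have as many edges as vertices, so their total is bounded independently of
  \<open>N\<close>.\<close>

lemma open_walks_error:
  assumes N: "p \<le> real N"
  shows "\<bar>\<Sum>i\<in>side N b. (\<Sum>ls\<in>loops ({..<N} - {i}) n (Suc r). \<mu> N (walk_edges i ls))
      - (\<Sum>j<N. if i \<noteq> j then \<Sum>ls\<in>{ls \<in> loops ({..<N} - {i}) n (Suc r). good j ls}. \<mu> N (walk_edges i ls) else 0)\<bar>
    \<le> moment_const p X n ^ n * fact (Suc n)"
proof -
  have N0: "0 < N" by (rule N_pos[OF N])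
  let ?L = "\<lambda>i. loops ({..<N} - {i}) n (Suc r)"
  let ?g = "\<lambda>i ls. moment_const p X n ^ n * (1 / real N) ^ card (set (walk i ls @ [i]))"
  have le: "\<bar>(\<Sum>ls\<in>?L i. \<mu> N (walk_edges i ls))
      - (\<Sum>j<N. if i \<noteq> j then \<Sum>ls\<in>{ls \<in> ?L i. good j ls}. \<mu> N (walk_edges i ls) else 0)\<bar>
    \<le> (\<Sum>ls\<in>?L i. ?g i ls)" for i
  proof -
    let ?G = "\<Union>j\<in>{..<N} - {i}. {ls \<in> ?L i. good j ls}"
    have "(\<Sum>j<N. if i \<noteq> j then \<Sum>ls\<in>{ls \<in> ?L i. good j ls}. \<mu> N (walk_edges i ls) else 0)
      = (\<Sum>j\<in>{..<N} - {i}. \<Sum>ls\<in>{ls \<in> ?L i. good j ls}. \<mu> N (walk_edges i ls))"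
      by (rule sum.mono_neutral_cong_right) auto
    also have "\<dots> = (\<Sum>ls\<in>?G. \<mu> N (walk_edges i ls))"
      by (rule sum.UNION_disjoint[symmetric]) (auto simp: good_def at_end_def)
    finally have "(\<Sum>ls\<in>?L i. \<mu> N (walk_edges i ls))
      - (\<Sum>j<N. if i \<noteq> j then \<Sum>ls\<in>{ls \<in> ?L i. good j ls}. \<mu> N (walk_edges i ls) else 0)
      = (\<Sum>ls\<in>?L i - ?G. \<mu> N (walk_edges i ls))"
      by (subst sum_diff) auto
    also have "\<bar>\<dots>\<bar> \<le> (\<Sum>ls\<in>?L i - ?G. ?g i ls)"
      by (rule order_trans[OF sum_abs sum_mono]) (auto intro!: edge_moment_not_good_bound[of _ "{..<N}" _ _ r] simp del: set_append)
    also have "\<dots> \<le> (\<Sum>ls\<in>?L i. ?g i ls)"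
      using moment_const_ge_1[of p X n] by (intro sum_mono2) auto
    finally show ?thesis .
  qed
  have "\<bar>\<Sum>i\<in>side N b. (\<Sum>ls\<in>?L i. \<mu> N (walk_edges i ls))
      - (\<Sum>j<N. if i \<noteq> j then \<Sum>ls\<in>{ls \<in> ?L i. good j ls}. \<mu> N (walk_edges i ls) else 0)\<bar>
    \<le> (\<Sum>i\<in>side N b. \<Sum>ls\<in>?L i. ?g i ls)"
    by (rule order_trans[OF sum_abs sum_mono]) (rule le)
  also have "\<dots> \<le> (\<Sum>i<N. \<Sum>ls\<in>?L i. ?g i ls)"
    using moment_const_ge_1[of p X n] side_subset by (intro sum_mono2 sum_nonneg) auto
  also have "\<dots> \<le> (\<Sum>w\<in>words {..<N} (Suc n). moment_const p X n ^ n * (1 / real N) ^ card (set w))"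
    using moment_const_ge_1[of p X n] by (intro sum_walks_le_sum_words) auto
  also have "\<dots> \<le> moment_const p X n ^ n * fact (Suc n)"
    unfolding sum_distrib_left[symmetric] using moment_const_ge_1[of p X n]
    by (intro mult_left_mono sum_words_card_le N0) auto
  finally show ?thesis .
qed

text \<open>Writing the restrictions on the pieces as an indicator puts both sums over the same
  index set, so that \<open>edge_moment_split_bound\<close> applies termwise. The weighted count of
  pairs of walks is bounded independently of \<open>N\<close>.\<close>

lemma split_walks_error:
  assumes N: "p \<le> real N" and k: "0 < k"
  shows "\<bar>\<Sum>i\<in>side N b. \<Sum>j<N.
      (if i \<noteq> j then \<Sum>ls1\<in>{ls \<in> loops ({..<N} - {i}) n r. \<forall>q\<in>set ls. off_end j q}. \<Sum>ls2\<in>loops ({..<N} - {i, j}) m v.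
           \<mu> N (replicate k (edge i j) @ walk_edges i ls1 @ walk_edges j ls2) else 0)
      - (\<Sum>ls1\<in>loops ({..<N} - {i}) n r. \<Sum>ls2\<in>loops ({..<N} - {j}) m v.
           \<mu> N (replicate k (edge i j)) * (\<mu> N (walk_edges i ls1) * \<mu> N (walk_edges j ls2)))\<bar>
    \<le> 2 * \<bar>p * X k\<bar> * (moment_const p X (n + m) ^ (n + m))\<^sup>2 * fact (Suc n + Suc m)"
proof -
  have N0: "0 < N" by (rule N_pos[OF N])
  let ?K = "2 * \<bar>p * X k\<bar> * (moment_const p X (n + m) ^ (n + m))\<^sup>2"
  let ?L = "\<lambda>i. loops ({..<N} - {i}) n r" and ?L' = "\<lambda>j. loops ({..<N} - {j}) m v"
  let ?g = "\<lambda>i j ls1 ls2. (1 / real N) ^ card (set (walk i ls1 @ [i]) \<union> set (walk j ls2 @ [j]))"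
  let ?t = "\<lambda>i j ls1 ls2. \<mu> N (replicate k (edge i j) @ walk_edges i ls1 @ walk_edges j ls2)"
  let ?s = "\<lambda>i j ls1 ls2. \<mu> N (replicate k (edge i j)) * (\<mu> N (walk_edges i ls1) * \<mu> N (walk_edges j ls2))"
  have le: "\<bar>(if i \<noteq> j then \<Sum>ls1\<in>{ls \<in> ?L i. \<forall>q\<in>set ls. off_end j q}. \<Sum>ls2\<in>loops ({..<N} - {i, j}) m v. ?t i j ls1 ls2 else 0)
      - (\<Sum>ls1\<in>?L i. \<Sum>ls2\<in>?L' j. ?s i j ls1 ls2)\<bar> \<le> (\<Sum>ls1\<in>?L i. \<Sum>ls2\<in>?L' j. ?K * ?g i j ls1 ls2)" for i j
  proof -
    let ?ind = "\<lambda>ls1 ls2. if i \<noteq> j \<and> (\<forall>q\<in>set ls1. off_end j q) \<and> (\<forall>q\<in>set ls2. i \<notin> set q) then ?t i j ls1 ls2 else 0"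
    have "(if i \<noteq> j then \<Sum>ls1\<in>{ls \<in> ?L i. \<forall>q\<in>set ls. off_end j q}. \<Sum>ls2\<in>loops ({..<N} - {i, j}) m v. ?t i j ls1 ls2 else 0)
      = (\<Sum>ls1\<in>?L i. \<Sum>ls2\<in>?L' j. ?ind ls1 ls2)"
    proof (cases "i = j")
      case False
      have "loops ({..<N} - {i, j}) m v = {ls \<in> ?L' j. \<forall>q\<in>set ls. i \<notin> set q}"
        by (auto simp: loops_def)
      then have "(\<Sum>ls2\<in>loops ({..<N} - {i, j}) m v. ?t i j ls1 ls2)
          = (\<Sum>ls2\<in>?L' j. if \<forall>q\<in>set ls2. i \<notin> set q then ?t i j ls1 ls2 else 0)" for ls1
        by (simp add: sum.inter_filter)
      moreover have "(\<Sum>ls1\<in>{ls \<in> ?L i. \<forall>q\<in>set ls. off_end j q}. f ls1)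
          = (\<Sum>ls1\<in>?L i. if \<forall>q\<in>set ls1. off_end j q then f ls1 else 0)" for f :: "nat list list \<Rightarrow> real"
        by (simp add: sum.inter_filter)
      moreover have "(if P then \<Sum>y\<in>Y. if Q y then f y else 0 else 0) = (\<Sum>y\<in>Y. if i \<noteq> j \<and> P \<and> Q y then f y else 0)"
        for P Q Y and f :: "nat list list \<Rightarrow> real"
        using False by (cases P) simp_all
      ultimately show ?thesis using False by (simp only: if_True simp_thms)
    qed simp
    then have "\<bar>(if i \<noteq> j then \<Sum>ls1\<in>{ls \<in> ?L i. \<forall>q\<in>set ls. off_end j q}. \<Sum>ls2\<in>loops ({..<N} - {i, j}) m v. ?t i j ls1 ls2 else 0)
      - (\<Sum>ls1\<in>?L i. \<Sum>ls2\<in>?L' j. ?s i j ls1 ls2)\<bar>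
      = \<bar>\<Sum>ls1\<in>?L i. \<Sum>ls2\<in>?L' j. ?ind ls1 ls2 - ?s i j ls1 ls2\<bar>"
      by (simp only: sum_subtractf)
    also have "\<dots> \<le> (\<Sum>ls1\<in>?L i. \<Sum>ls2\<in>?L' j. ?K * ?g i j ls1 ls2)"
      by (rule order_trans[OF sum_abs sum_mono], rule order_trans[OF sum_abs sum_mono])
        (rule edge_moment_split_bound[OF N0 _ _ k])
    finally show ?thesis .
  qed
  have "\<bar>\<Sum>i\<in>side N b. \<Sum>j<N. (if i \<noteq> j then \<Sum>ls1\<in>{ls \<in> ?L i. \<forall>q\<in>set ls. off_end j q}. \<Sum>ls2\<in>loops ({..<N} - {i, j}) m v. ?t i j ls1 ls2 else 0)
      - (\<Sum>ls1\<in>?L i. \<Sum>ls2\<in>?L' j. ?s i j ls1 ls2)\<bar>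
    \<le> (\<Sum>i\<in>side N b. \<Sum>j<N. \<Sum>ls1\<in>?L i. \<Sum>ls2\<in>?L' j. ?K * ?g i j ls1 ls2)"
    by (rule order_trans[OF sum_abs sum_mono], rule order_trans[OF sum_abs sum_mono]) (rule le)
  also have "\<dots> \<le> (\<Sum>i<N. \<Sum>j<N. \<Sum>ls1\<in>?L i. \<Sum>ls2\<in>?L' j. ?K * ?g i j ls1 ls2)"
    using side_subset by (intro sum_mono2 sum_nonneg) auto
  also have "\<dots> = ?K * (\<Sum>i<N. \<Sum>j<N. \<Sum>ls1\<in>?L i. \<Sum>ls2\<in>?L' j. ?g i j ls1 ls2)"
    by (simp only: sum_distrib_left)
  also have "\<dots> \<le> ?K * fact (Suc n + Suc m)"
    by (intro mult_left_mono sum_walk_pairs_card_le N0) auto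
  finally show ?thesis .
qed

text \<open>The repeated edge has a nonzero factor only if \<open>j\<close> is on the other side,
  whence \<open>\<not> b\<close>, and then the sum factorises. The normalisations of the two
  \<open>\<sigma>\<close> supply \<open>N^2\<close>, of which the edge removes one factor.\<close>

lemma split_walks_main_term:
  assumes N: "p \<le> real N" and k: "0 < k"
  shows "(\<Sum>i\<in>side N b. \<Sum>j<N. \<Sum>ls1\<in>loops ({..<N} - {i}) n r. \<Sum>ls2\<in>loops ({..<N} - {j}) m v.
           \<mu> N (replicate k (edge i j)) * (\<mu> N (walk_edges i ls1) * \<mu> N (walk_edges j ls2)))
    = real N * (p * X k * (\<sigma> N b n r * \<sigma> N (\<not> b) m v))"
proof -
  have N0: "0 < N" by (rule N_pos[OF N])
  define f where "f i = (\<Sum>ls\<in>loops ({..<N} - {i}) n r. \<mu> N (walk_edges i ls))" for i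
  define g where "g j = (\<Sum>ls\<in>loops ({..<N} - {j}) m v. \<mu> N (walk_edges j ls))" for j
  have "(\<Sum>i\<in>side N b. \<Sum>j<N. \<Sum>ls1\<in>loops ({..<N} - {i}) n r. \<Sum>ls2\<in>loops ({..<N} - {j}) m v.
           \<mu> N (replicate k (edge i j)) * (\<mu> N (walk_edges i ls1) * \<mu> N (walk_edges j ls2)))
    = (\<Sum>i\<in>side N b. \<Sum>j<N. \<mu> N (replicate k (edge i j)) * (f i * g j))"
    unfolding f_def g_def by (simp only: sum_product) (simp only: sum_distrib_left)
  also have "\<dots> = (\<Sum>i\<in>side N b. \<Sum>j\<in>side N (\<not> b). p / real N * X k * (f i * g j))"
  proof (rule sum.cong[OF refl], rule sum.mono_neutral_cong_right)
    fix i assume i: "i \<in> side N b"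
    have \<mu>: "\<mu> N (replicate k (edge i j)) = (if (i < cut N) \<noteq> (j < cut N) then p / real N * X k else 0)" for j
      unfolding edge_moment_replicate[OF k] by (auto simp: edge_def min_def max_def)
    show "\<forall>j\<in>{..<N} - side N (\<not> b). \<mu> N (replicate k (edge i j)) * (f i * g j) = 0"
      using i by (auto simp: \<mu> side_def)
    show "\<mu> N (replicate k (edge i j)) * (f i * g j) = p / real N * X k * (f i * g j)"
      if "j \<in> side N (\<not> b)" for j
      using i that by (auto simp: \<mu> side_def)
  qed (use side_subset in auto)
  also have "\<dots> = p / real N * X k * ((\<Sum>i\<in>side N b. f i) * (\<Sum>j\<in>side N (\<not> b). g j))"
    by (simp only: sum_product) (simp only: sum_distrib_left)
  also have "\<dots> = real N * (p * X k * (\<sigma> N b n r * \<sigma> N (\<not> b) m v))"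
    unfolding \<sigma>_def f_def g_def using N0 by (simp add: field_simps)
  finally show ?thesis .
qed

text \<open>The recursion for \<open>S\<close> in terms of the full length \<open>n = 2 l\<close> and of \<open>k = f - 1\<close>.\<close>

definition rec_rhs :: "(bool \<Rightarrow> nat \<Rightarrow> nat \<Rightarrow> real) \<Rightarrow> bool \<Rightarrow> nat \<Rightarrow> nat \<Rightarrow> real" where
  "rec_rhs s b n r = (\<Sum>k\<le>r. real (r choose k) * (if n < 2 * Suc k then 0 else
     \<Sum>u\<le>n - 2 * Suc k. \<Sum>v\<le>u. real ((k + v) choose k) *
       (p * X (2 * Suc k) * (s b (n - 2 * Suc k - u) (r - k) * s (\<not> b) u v))))"

text \<open>After multiplication by \<open>N\<close> two replacements are made, each with an error
  bounded in \<open>N\<close>: all walks by the good ones, and the coupled pairs of pieces by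
  uncoupled ones, whose sum is the product of two \<open>\<sigma>\<close>.\<close>

lemma \<sigma>_recursion:
  "\<exists>C. \<forall>N. p \<le> real N \<longrightarrow> \<bar>\<sigma> N b n (Suc r) - rec_rhs (\<sigma> N) b n r\<bar> \<le> C / real N"
proof -
  define B where "B k u = 2 * \<bar>p * X (2 * Suc k)\<bar> * (moment_const p X (n - 2 * Suc k - u + u) ^ (n - 2 * Suc k - u + u))\<^sup>2
      * fact (Suc (n - 2 * Suc k - u) + Suc u)" for k u
  define C where "C = moment_const p X n ^ n * fact (Suc n) + (\<Sum>k\<le>r. real (r choose k) * (if n < 2 * Suc k then 0 else
     \<Sum>u\<le>n - 2 * Suc k. \<Sum>v\<le>u. real ((k + v) choose k) * B k u))"
  have "\<bar>\<sigma> N b n (Suc r) - rec_rhs (\<sigma> N) b n r\<bar> \<le> C / real N" if N: "p \<le> real N" for N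
  proof -
    have N0: "0 < N" by (rule N_pos[OF N])
    \<comment> \<open>The diagonal gets the value 0, so that the sum over pairs
      \<open>(i, j)\<close> ranges over a plain product and can be exchanged with those over
      \<open>k\<close>, \<open>u\<close> and \<open>v\<close>.\<close>
    define T where "T = (\<lambda>(i, j) k u v. if i \<noteq> j then
        \<Sum>ls1\<in>{ls \<in> loops ({..<N} - {i}) (n - 2 * Suc k - u) (r - k). \<forall>q\<in>set ls. off_end j q}.
           \<Sum>ls2\<in>loops ({..<N} - {i, j}) u v.
             \<mu> N (replicate (2 * Suc k) (edge i j) @ walk_edges i ls1 @ walk_edges j ls2) else 0)"
    define Z where "Z = side N b \<times> {..<N}"
    let ?good = "\<lambda>i j. \<Sum>ls\<in>{ls \<in> loops ({..<N} - {i}) n (Suc r). good j ls}. \<mu> N (walk_edges i ls)"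
    have D: "\<bar>(\<Sum>z\<in>Z. T z k u v) - real N * (p * X (2 * Suc k) * (\<sigma> N b (n - 2 * Suc k - u) (r - k) * \<sigma> N (\<not> b) u v))\<bar> \<le> B k u" for k u v
    proof -
      have "(\<Sum>z\<in>Z. T z k u v) = (\<Sum>i\<in>side N b. \<Sum>j<N. T (i, j) k u v)"
        unfolding Z_def by (simp add: sum.cartesian_product)
      then show ?thesis
        using split_walks_error[OF N, where k = "2 * Suc k" and b = b
            and n = "n - 2 * Suc k - u" and r = "r - k" and m = u and v = v]
          split_walks_main_term[OF N, where k = "2 * Suc k" and b = b
            and n = "n - 2 * Suc k - u" and r = "r - k" and m = u and v = v]
        unfolding T_def B_def prod.case sum_subtractf by simp
    qed
    have "(\<Sum>i\<in>side N b. \<Sum>j<N. if i \<noteq> j then ?good i j else 0) = (\<Sum>z\<in>Z. case z of (i, j) \<Rightarrow> if i \<noteq> j then ?good i j else 0)"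
      unfolding Z_def by (simp add: sum.cartesian_product)
    also have "\<dots> = (\<Sum>z\<in>Z. \<Sum>k\<le>r. real (r choose k) * (if n < 2 * Suc k then 0 else
        \<Sum>u\<le>n - 2 * Suc k. \<Sum>v\<le>u. real ((k + v) choose k) * T z k u v))"
    proof (intro sum.cong refl)
      fix z assume "z \<in> Z"
      then obtain i j where z: "z = (i, j)" "i < N" "j < N" by (auto simp: Z_def side_def)
      show "(case z of (i, j) \<Rightarrow> if i \<noteq> j then ?good i j else 0) = (\<Sum>k\<le>r. real (r choose k) * (if n < 2 * Suc k then 0 else
        \<Sum>u\<le>n - 2 * Suc k. \<Sum>v\<le>u. real ((k + v) choose k) * T z k u v))"
      proof (cases "i = j")
        case True
        have "T z k u v = 0" for k u v using True by (simp add: T_def z)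
        moreover have "(case z of (i, j) \<Rightarrow> if i \<noteq> j then ?good i j else 0) = 0" using True by (simp add: z)
        ultimately show ?thesis by (simp only: mult_zero_right sum.neutral_const if_cancel)
      next
        case False
        have "T z k u v = (\<Sum>ls1\<in>{ls \<in> loops ({..<N} - {i}) (n - 2 * Suc k - u) (r - k). \<forall>q\<in>set ls. off_end j q}.
           \<Sum>ls2\<in>loops ({..<N} - {i, j}) u v.
             \<mu> N (replicate (2 * Suc k) (edge i j) @ walk_edges i ls1 @ walk_edges j ls2))" for k u v
          using False by (simp only: T_def z prod.case if_True simp_thms)
        then show ?thesis
          using False good_walks_moment[OF N z(2,3) False, of n r] by (simp only: z prod.case if_True simp_thms)
      qed
    qed
    also have "\<dots> = (\<Sum>k\<le>r. real (r choose k) * (if n < 2 * Suc k then 0 else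
        \<Sum>u\<le>n - 2 * Suc k. \<Sum>v\<le>u. real ((k + v) choose k) * (\<Sum>z\<in>Z. T z k u v)))"
      by (rule sum_pull_out)
    finally have good: "(\<Sum>i\<in>side N b. \<Sum>j<N. if i \<noteq> j then ?good i j else 0) = \<dots>" .
    have "\<bar>(\<Sum>i\<in>side N b. \<Sum>j<N. if i \<noteq> j then ?good i j else 0) - real N * rec_rhs (\<sigma> N) b n r\<bar>
      = \<bar>\<Sum>k\<le>r. real (r choose k) * (if n < 2 * Suc k then 0 else
        \<Sum>u\<le>n - 2 * Suc k. \<Sum>v\<le>u. real ((k + v) choose k) * ((\<Sum>z\<in>Z. T z k u v)
          - real N * (p * X (2 * Suc k) * (\<sigma> N b (n - 2 * Suc k - u) (r - k) * \<sigma> N (\<not> b) u v))))\<bar>"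
      unfolding good rec_rhs_def sum_diff_combine ..
    also have "\<dots> \<le> (\<Sum>k\<le>r. real (r choose k) * (if n < 2 * Suc k then 0 else
     \<Sum>u\<le>n - 2 * Suc k. \<Sum>v\<le>u. real ((k + v) choose k) * B k u))"
    proof (rule order_trans[OF sum_abs sum_mono])
      fix k
      have "\<bar>\<Sum>u\<le>n - 2 * Suc k. \<Sum>v\<le>u. real ((k + v) choose k) * ((\<Sum>z\<in>Z. T z k u v)
          - real N * (p * X (2 * Suc k) * (\<sigma> N b (n - 2 * Suc k - u) (r - k) * \<sigma> N (\<not> b) u v)))\<bar>
        \<le> (\<Sum>u\<le>n - 2 * Suc k. \<Sum>v\<le>u. real ((k + v) choose k) * B k u)"
        by (rule order_trans[OF sum_abs sum_mono], rule order_trans[OF sum_abs sum_mono],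
            unfold abs_mult[of "real _"] abs_of_nat, rule mult_left_mono[OF D]) auto
      then show "\<bar>real (r choose k) * (if n < 2 * Suc k then 0 else
        \<Sum>u\<le>n - 2 * Suc k. \<Sum>v\<le>u. real ((k + v) choose k) * ((\<Sum>z\<in>Z. T z k u v)
          - real N * (p * X (2 * Suc k) * (\<sigma> N b (n - 2 * Suc k - u) (r - k) * \<sigma> N (\<not> b) u v))))\<bar>
        \<le> real (r choose k) * (if n < 2 * Suc k then 0 else
          \<Sum>u\<le>n - 2 * Suc k. \<Sum>v\<le>u. real ((k + v) choose k) * B k u)"
        by (rule abs_mult_if_le) simp
    qed
    finally have 1: "\<bar>(\<Sum>i\<in>side N b. \<Sum>j<N. if i \<noteq> j then ?good i j else 0) - real N * rec_rhs (\<sigma> N) b n r\<bar> \<le> \<dots>" .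
    have 2: "\<bar>real N * \<sigma> N b n (Suc r) - (\<Sum>i\<in>side N b. \<Sum>j<N. if i \<noteq> j then ?good i j else 0)\<bar>
      \<le> moment_const p X n ^ n * fact (Suc n)"
      using open_walks_error[OF N, where b = b and n = n and r = r] N0 unfolding \<sigma>_def sum_subtractf by simp
    have "real N * \<bar>\<sigma> N b n (Suc r) - rec_rhs (\<sigma> N) b n r\<bar> = \<bar>real N * \<sigma> N b n (Suc r) - real N * rec_rhs (\<sigma> N) b n r\<bar>"
      by (simp add: abs_mult flip: right_diff_distrib)
    also have "\<dots> \<le> C" using 1 2 unfolding C_def by linarith
    finally show ?thesis using N0 by (simp add: field_simps)
  qed
  then show ?thesis by blast
qed

end

context sparse_bipartite
begin

definition \<sigma>_lim :: "bool \<Rightarrow> nat \<Rightarrow> nat \<Rightarrow> real" where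
  "\<sigma>_lim b n r = (if even n then S_rec p \<alpha> X b (n div 2) r else 0)"

lemma sum_even_restrict:
  fixes g :: "nat \<Rightarrow> real"
  assumes "\<And>u. odd u \<Longrightarrow> g u = 0"
  shows "(\<Sum>u\<le>2 * m. g u) = (\<Sum>u\<le>m. g (2 * u))"
  using assms by (induction m) auto

text \<open>For odd \<open>n\<close> one of the lengths \<open>n - 2 * Suc k - u\<close> and
  \<open>u\<close> is odd, so every product vanishes. For even \<open>n\<close> only even
  \<open>u\<close> survive and all lengths can be halved. The ranges here exceed those of the
  recursion, but the extra terms have the second index above the first and are 0 by
  \<open>S_rec_above\<close>.\<close>

lemma rec_rhs_\<sigma>_lim: "rec_rhs \<sigma>_lim b n r = \<sigma>_lim b n (Suc r)"
proof (cases "even n")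
  case False
  then have *: "\<sigma>_lim b (n - 2 * Suc k - u) (r - k) * \<sigma>_lim (\<not> b) u v = 0" if "\<not> n < 2 * Suc k" "u \<le> n - 2 * Suc k" for k u v
    using that by (auto simp: \<sigma>_lim_def)
  have "(if n < 2 * Suc k then 0 else
     \<Sum>u\<le>n - 2 * Suc k. \<Sum>v\<le>u. real ((k + v) choose k) *
       (p * X (2 * Suc k) * (\<sigma>_lim b (n - 2 * Suc k - u) (r - k) * \<sigma>_lim (\<not> b) u v))) = 0" for k
  proof (cases "n < 2 * Suc k")
    case False
    then show ?thesis
      unfolding if_not_P[OF False] by (intro sum.neutral ballI) (subst *, simp_all)
  qed simp
  then show ?thesis using False by (simp only: rec_rhs_def \<sigma>_lim_def if_False mult_zero_right sum.neutral_const)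
next
  case True
  then obtain l where n: "n = 2 * l" by auto
  let ?S = "S_rec p \<alpha> X"
  have inner: "(\<Sum>v\<le>2 * u. real ((k + v) choose k) * (c * (y * ?S (\<not> b) u v)))
      = c * (y * (\<Sum>v = 0..u. real ((k + v) choose k) * ?S (\<not> b) u v))" for k u c y
  proof -
    have "(\<Sum>v\<le>2 * u. real ((k + v) choose k) * (c * (y * ?S (\<not> b) u v)))
      = (\<Sum>v = 0..u. real ((k + v) choose k) * (c * (y * ?S (\<not> b) u v)))"
      by (rule sum.mono_neutral_right) (auto simp: S_rec_above)
    then show ?thesis by (simp add: sum_distrib_left mult_ac)
  qed
  have summand: "(if n < 2 * Suc k then 0 else
     \<Sum>u\<le>n - 2 * Suc k. \<Sum>v\<le>u. real ((k + v) choose k) *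
       (p * X (2 * Suc k) * (\<sigma>_lim b (n - 2 * Suc k - u) (r - k) * \<sigma>_lim (\<not> b) u v)))
    = (if l < Suc r then 0 else p * X (2 * Suc k) * (\<Sum>u = 0..l - Suc r. ?S b (l - u - Suc k) (r - k) *
         (\<Sum>v = 0..u. real ((k + v) choose k) * ?S (\<not> b) u v)))" if k: "k \<le> r" for k
  proof (cases "l < Suc k")
    case False
    have "(\<Sum>u\<le>n - 2 * Suc k. \<Sum>v\<le>u. real ((k + v) choose k) *
       (p * X (2 * Suc k) * (\<sigma>_lim b (n - 2 * Suc k - u) (r - k) * \<sigma>_lim (\<not> b) u v)))
      = (\<Sum>u\<le>l - Suc k. \<Sum>v\<le>2 * u. real ((k + v) choose k) *
       (p * X (2 * Suc k) * (\<sigma>_lim b (n - 2 * Suc k - 2 * u) (r - k) * \<sigma>_lim (\<not> b) (2 * u) v)))"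
    proof -
      have "n - 2 * Suc k = 2 * (l - Suc k)" using n by simp
      then show ?thesis by (simp only:) (rule sum_even_restrict, simp add: \<sigma>_lim_def)
    qed
    also have "\<dots> = (\<Sum>u\<le>l - Suc k. p * X (2 * Suc k) * (?S b (l - u - Suc k) (r - k) *
         (\<Sum>v = 0..u. real ((k + v) choose k) * ?S (\<not> b) u v)))"
    proof (rule sum.cong[OF refl])
      fix u
      have "\<sigma>_lim b (n - 2 * Suc k - 2 * u) (r - k) = ?S b (l - u - Suc k) (r - k)"
      proof -
        have "n - 2 * Suc k - 2 * u = 2 * (l - u - Suc k)" using n by simp
        then show ?thesis by (simp only: \<sigma>_lim_def) simp
      qed
      moreover have "\<sigma>_lim (\<not> b) (2 * u) v = ?S (\<not> b) u v" for v by (simp add: \<sigma>_lim_def)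
      ultimately show "(\<Sum>v\<le>2 * u. real ((k + v) choose k) *
       (p * X (2 * Suc k) * (\<sigma>_lim b (n - 2 * Suc k - 2 * u) (r - k) * \<sigma>_lim (\<not> b) (2 * u) v)))
        = p * X (2 * Suc k) * (?S b (l - u - Suc k) (r - k) * (\<Sum>v = 0..u. real ((k + v) choose k) * ?S (\<not> b) u v))"
        by (simp only: inner)
    qed
    also have "\<dots> = (if l < Suc r then 0 else (\<Sum>u = 0..l - Suc r. p * X (2 * Suc k) * (?S b (l - u - Suc k) (r - k) *
         (\<Sum>v = 0..u. real ((k + v) choose k) * ?S (\<not> b) u v))))"
    proof (cases "l < Suc r")
      case True
      then have "?S b (l - u - Suc k) (r - k) = 0" for u
        using False k by (intro S_rec_above) auto
      then show ?thesis using True by simp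
    next
      case l: False
      then show ?thesis using k by (auto simp: S_rec_above intro!: sum.mono_neutral_right)
    qed
    finally show ?thesis using False n
      by (simp only: sum_distrib_left) simp
  qed (use k n in auto)
  show ?thesis
  proof (cases "l < Suc r")
    case True
    have "rec_rhs \<sigma>_lim b n r = 0"
      unfolding rec_rhs_def by (intro sum.neutral ballI) (simp only: summand atMost_iff True if_True mult_zero_right)
    then show ?thesis using True n by (simp add: \<sigma>_lim_def S_rec_above)
  next
    case False
    have "rec_rhs \<sigma>_lim b n r = (\<Sum>k\<le>r. real (r choose k) * (p * X (2 * Suc k) * (\<Sum>u = 0..l - Suc r. ?S b (l - u - Suc k) (r - k) *
         (\<Sum>v = 0..u. real ((k + v) choose k) * ?S (\<not> b) u v))))"
      unfolding rec_rhs_def by (rule sum.cong[OF refl]) (simp only: summand atMost_iff False if_False)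
    also have "\<dots> = (\<Sum>f = 1..Suc r. p * (real (r choose (f - 1)) * X (2 * f) * (\<Sum>u = 0..l - Suc r. ?S b (l - u - f) (Suc r - f) *
         (\<Sum>v = 0..u. real ((f + v - 1) choose (f - 1)) * ?S (\<not> b) u v))))"
      by (rule sum.reindex_bij_witness[of _ "\<lambda>f. f - 1" Suc]) auto
    also have "\<dots> = ?S b l (Suc r)"
      using False unfolding sum_distrib_left[symmetric] by (subst S_rec_unfold[of "Suc r" l]) simp_all
    finally show ?thesis using n by (simp add: \<sigma>_lim_def)
  qed
qed

section \<open>Proportions of the two sides and passage to the limit\<close>

lemma cut_fraction_tendsto: "(\<lambda>N. real (cut N) / real N) \<longlonglongrightarrow> \<alpha>"
proof (rule tendsto_sandwich[where f = "\<lambda>N. \<alpha> - 1 / real N" and h = "\<lambda>_. \<alpha>"])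
  have cut: "\<alpha> * real N - 1 \<le> real (cut N)" "real (cut N) \<le> \<alpha> * real N" for N
    using alpha by (auto simp: cut_def)
  show "\<forall>\<^sub>F N in sequentially. \<alpha> - 1 / real N \<le> real (cut N) / real N"
    using eventually_gt_at_top[of 0]
  proof eventually_elim
    case (elim N)
    have "\<alpha> - 1 / real N = (\<alpha> * real N - 1) / real N" using elim by (simp add: diff_divide_distrib)
    also have "\<dots> \<le> real (cut N) / real N" by (intro divide_right_mono cut) simp
    finally show ?case .
  qed
  show "\<forall>\<^sub>F N in sequentially. real (cut N) / real N \<le> \<alpha>"
    using eventually_gt_at_top[of 0] by eventually_elim (use cut in \<open>auto simp: field_simps\<close>)
  show "(\<lambda>N. \<alpha> - 1 / real N) \<longlonglongrightarrow> \<alpha>"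
    using tendsto_diff[OF tendsto_const[of \<alpha>] lim_1_over_n] by simp
qed simp

lemma side_fraction_tendsto:
  "(\<lambda>N. real (card (side N b)) / real N) \<longlonglongrightarrow> (if b then \<alpha> else 1 - \<alpha>)"
proof -
  have le: "cut N \<le> N" for N
  proof -
    have "\<alpha> * real N \<le> real N" using alpha by (simp add: mult_left_le_one_le)
    then show ?thesis unfolding cut_def by linarith
  qed
  have T: "side N True = {..<cut N}" and F: "side N False = {cut N..<N}" for N
    using le[of N] by (auto simp: side_def)
  show ?thesis
  proof (cases b)
    case True
    then show ?thesis using cut_fraction_tendsto by (simp add: T)
  next
    case False
    have "(\<lambda>N. 1 - real (cut N) / real N) \<longlonglongrightarrow> 1 - \<alpha>"
      by (intro tendsto_intros cut_fraction_tendsto)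
    moreover have "\<forall>\<^sub>F N in sequentially. 1 - real (cut N) / real N = real (card (side N b)) / real N"
      using eventually_gt_at_top[of 0]
      by eventually_elim (use False le in \<open>simp add: F of_nat_diff diff_divide_distrib\<close>)
    ultimately show ?thesis using False by (simp add: Lim_transform_eventually)
  qed
qed

text \<open>\<open>rec_rhs\<close> at \<open>n\<close> refers only to lengths below
  \<open>n\<close>, since the repeated edge takes at least two steps. For \<open>r = 0\<close> only
  the walk of length 0 exists, and the limit is the proportion of the side, which gives the initial
  values of the recursion.\<close>

lemma \<sigma>_tendsto: "(\<lambda>N. \<sigma> N b n r) \<longlonglongrightarrow> \<sigma>_lim b n r"
proof (induction n arbitrary: b r rule: less_induct)
  case (less n)
  show ?case
  proof (cases r)
    case 0
    show ?thesis
    proof (cases "n = 0")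
      case True
      then show ?thesis using side_fraction_tendsto[of b] 0
        by (simp add: \<sigma>_def \<sigma>_lim_def loops_0 S_rec_at_0)
    next
      case False
      then have "\<sigma>_lim b n r = 0" using 0 by (auto simp: \<sigma>_lim_def S_rec_at_0)
      then show ?thesis using 0 False by (simp add: \<sigma>_def loops_0)
    qed
  next
    case (Suc r')
    obtain C where C: "\<And>N. p \<le> real N \<Longrightarrow> \<bar>\<sigma> N b n (Suc r') - rec_rhs (\<sigma> N) b n r'\<bar> \<le> C / real N"
      using \<sigma>_recursion[of b n r'] by blast
    have "(\<lambda>N. \<sigma> N b n (Suc r') - rec_rhs (\<sigma> N) b n r') \<longlonglongrightarrow> 0"
    proof (rule Lim_null_comparison)
      show "\<forall>\<^sub>F N in sequentially. norm (\<sigma> N b n (Suc r') - rec_rhs (\<sigma> N) b n r') \<le> C / real N"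
        using eventually_N by eventually_elim (use C in simp)
      show "(\<lambda>N. C / real N) \<longlonglongrightarrow> 0" by (rule lim_const_over_n)
    qed
    moreover have "(\<lambda>N. rec_rhs (\<sigma> N) b n r') \<longlonglongrightarrow> rec_rhs \<sigma>_lim b n r'"
      unfolding rec_rhs_def
    proof (intro tendsto_sum tendsto_mult tendsto_const)
      fix k
      have "(\<lambda>N. \<Sum>u\<le>n - 2 * Suc k. \<Sum>v\<le>u. real ((k + v) choose k) *
         (p * X (2 * Suc k) * (\<sigma> N b (n - 2 * Suc k - u) (r' - k) * \<sigma> N (\<not> b) u v)))
        \<longlonglongrightarrow> (\<Sum>u\<le>n - 2 * Suc k. \<Sum>v\<le>u. real ((k + v) choose k) *
         (p * X (2 * Suc k) * (\<sigma>_lim b (n - 2 * Suc k - u) (r' - k) * \<sigma>_lim (\<not> b) u v)))" if "\<not> n < 2 * Suc k"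
        by (intro tendsto_sum tendsto_mult tendsto_const less.IH) (use that in auto)
      then show "(\<lambda>N. if n < 2 * Suc k then 0 else \<Sum>u\<le>n - 2 * Suc k. \<Sum>v\<le>u. real ((k + v) choose k) *
         (p * X (2 * Suc k) * (\<sigma> N b (n - 2 * Suc k - u) (r' - k) * \<sigma> N (\<not> b) u v)))
        \<longlonglongrightarrow> (if n < 2 * Suc k then 0 else \<Sum>u\<le>n - 2 * Suc k. \<Sum>v\<le>u. real ((k + v) choose k) *
         (p * X (2 * Suc k) * (\<sigma>_lim b (n - 2 * Suc k - u) (r' - k) * \<sigma>_lim (\<not> b) u v)))"
        by (cases "n < 2 * Suc k") (simp_all only: if_True if_False tendsto_const simp_thms)
    qed
    ultimately have "(\<lambda>N. (\<sigma> N b n (Suc r') - rec_rhs (\<sigma> N) b n r') + rec_rhs (\<sigma> N) b n r')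
        \<longlonglongrightarrow> 0 + rec_rhs \<sigma>_lim b n r'"
      by (rule tendsto_add)
    then show ?thesis by (simp add: Suc rec_rhs_\<sigma>_lim)
  qed
qed

lemma norm_moment_tendsto:
  "(\<lambda>N. expectation (norm_moment a d \<alpha> N n)) \<longlonglongrightarrow> (\<Sum>r\<le>n. \<sigma>_lim True n r + \<sigma>_lim False n r)"
proof (rule Lim_transform_eventually)
  show "(\<lambda>N. \<Sum>r\<le>n. \<sigma> N True n r + \<sigma> N False n r) \<longlonglongrightarrow> (\<Sum>r\<le>n. \<sigma>_lim True n r + \<sigma>_lim False n r)"
    by (intro tendsto_intros \<sigma>_tendsto)
  show "\<forall>\<^sub>F N in sequentially. (\<Sum>r\<le>n. \<sigma> N True n r + \<sigma> N False n r) = expectation (norm_moment a d \<alpha> N n)"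
    using eventually_N by eventually_elim (simp add: expectation_norm_moment)
qed

lemma even_moment_tendsto:
  "(\<lambda>N. expectation (norm_moment a d \<alpha> N (2 * k))) \<longlonglongrightarrow> lim_moment p \<alpha> X k"
proof -
  have "(\<Sum>r\<le>2 * k. \<sigma>_lim True (2 * k) r + \<sigma>_lim False (2 * k) r)
      = (\<Sum>r = 0..k. S_rec p \<alpha> X True k r + S_rec p \<alpha> X False k r)"
    by (rule sum.mono_neutral_cong_right) (auto simp: \<sigma>_lim_def S_rec_above)
  then show ?thesis
    using norm_moment_tendsto[of "2 * k"] by (simp add: lim_moment_def S1_def S2_def)
qed

lemma odd_moment_tendsto:
  assumes "odd n"
  shows "(\<lambda>N. expectation (norm_moment a d \<alpha> N n)) \<longlonglongrightarrow> 0"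
  using norm_moment_tendsto[of n] assms by (simp add: \<sigma>_lim_def)

lemma even_X_nonneg: "0 \<le> X (2 * m)"
  unfolding X_def by (intro integral_nonneg_AE) (auto simp: zero_le_even_power)

end

theorem theorem2:
  fixes M :: "'a measure"
    and a :: "nat \<Rightarrow> nat \<Rightarrow> 'a \<Rightarrow> real"
    and d :: "nat \<Rightarrow> nat \<Rightarrow> nat \<Rightarrow> 'a \<Rightarrow> real"
    and p \<alpha> :: real
    and X :: "nat \<Rightarrow> real"
  assumes "prob_space M"
    and p_pos: "p > 0"
    and alpha: "0 < \<alpha>" "\<alpha> < 1"
    and a_sym: "\<And>i j. a j i = a i j"
    and a_ident: "\<And>i j. i \<le> j \<Longrightarrow> distr M borel (a i j) = distr M borel (a 0 0)"
    and a_moments: "\<And>i j k. integrable M (\<lambda>x. a i j x ^ k)"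
    and X_def: "\<And>k. X k = prob_space.expectation M (\<lambda>x. a 0 0 x ^ k)"
    and d_sym: "\<And>N i j. d N j i = d N i j"
    and d_bern: "\<And>N i j. real N \<ge> p \<Longrightarrow> i \<le> j \<Longrightarrow> j < N \<Longrightarrow>
                   (\<forall>x\<in>space M. d N i j x \<in> {0, 1}) \<and>
                   measure M {x \<in> space M. d N i j x = 1} = p / real N"
    and indep: "\<And>N. real N \<ge> p \<Longrightarrow>
                  prob_space.indep_vars M (\<lambda>_. borel)
                    (\<lambda>ij. case ij of Inl (i, j) \<Rightarrow> a i j | Inr (i, j) \<Rightarrow> d N i j)
                    ({(i, j). i \<le> j} <+> {(i, j). i \<le> j \<and> j < N})"
    and X_growth: "\<exists>C::real. \<forall>m::nat. X (2 * m) \<le> (C * real m) ^ (2 * m)"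
  shows "(\<forall>k m. \<exists>c::real. \<forall>\<^sub>F N in sequentially.
            prob_space.expectation M (\<lambda>x. norm_moment a d \<alpha> N k x * norm_moment a d \<alpha> N m x)
            - prob_space.expectation M (norm_moment a d \<alpha> N k)
              * prob_space.expectation M (norm_moment a d \<alpha> N m) \<le> c / real N)
       \<and> (\<forall>k. (\<lambda>N. prob_space.expectation M (norm_moment a d \<alpha> N (2 * k)))
                 \<longlonglongrightarrow> lim_moment p \<alpha> X k)
       \<and> (\<forall>k\<ge>1. (\<lambda>N. prob_space.expectation M (norm_moment a d \<alpha> N (2 * k - 1)))
                 \<longlonglongrightarrow> 0)
       \<and> (\<Sum>k. carleman_term (lim_moment p \<alpha> X (Suc k)) (Suc k)) = \<infinity>"
proof -
  interpret prob_space M by (rule assms(1))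
  interpret sparse_bipartite M a d p \<alpha> X
    by unfold_locales (fact p_pos alpha a_sym a_ident a_moments X_def d_sym d_bern indep)+
  have "\<exists>c. \<forall>\<^sub>F N in sequentially.
      expectation (\<lambda>x. norm_moment a d \<alpha> N k x * norm_moment a d \<alpha> N m x)
      - expectation (norm_moment a d \<alpha> N k) * expectation (norm_moment a d \<alpha> N m) \<le> c / real N" for k m
    \<comment> \<open>The constant is read off from \<open>covariance_bound\<close>, where it is
      free of \<open>N\<close>, and the estimate holds from \<open>N \<ge> p\<close> on.\<close>
    by (intro exI eventually_mono[OF eventually_N]) (rule covariance_bound)
  moreover have "(\<lambda>N. expectation (norm_moment a d \<alpha> N (2 * k - 1))) \<longlonglongrightarrow> 0" if "k \<ge> 1" for k
    using that by (intro odd_moment_tendsto) simp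
  moreover obtain C where "\<And>m. X (2 * m) \<le> (C * real m) ^ (2 * m)" using X_growth by blast
  then have "(\<Sum>k. carleman_term (lim_moment p \<alpha> X (Suc k)) (Suc k)) = \<infinity>"
    using alpha by (intro carleman_lim_moment[of p \<alpha> X C] p_pos even_X_nonneg) auto
  ultimately show ?thesis using even_moment_tendsto by blast
qed

end
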